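(* For every odd prime power $q$ and every integer $m\geq 1$, there exists a finite metabelian group $G_{m,q}$ such that \[ |G_{m,q}|=2q^{2m+1},\qquad Z_\infty(G_{m,q})=1,\qquad |\Phi(G_{m,q})|=q, \] and the least number of system normalizers of $G_{m,q}$ whose intersection is the hypercenter $Z_\infty(G_{m,q})$ is $m+1$. For the Frattini quotient $G_{m,q}/\Phi(G_{m,q})$, the least number of system normalizers of $G_{m,q}/\Phi(G_{m,q})$ whose intersection is the hypercenter $Z_\infty(G_{m,q}/\Phi(G_{m,q}))$ is two.
   Context: A group is metabelian if its commutator subgroup is abelian. For a finite group $G$, $\Phi(G)$ is the Frattini subgroup (the intersection of all maximal subgroups of $G$). The upper central series is $Z_0(G)=1$, $Z_{i+1}(G)/Z_i(G)=Z(G/Z_i(G))$ for $i\ge 0$, where $Z(\cdot)$ denotes the center; for finite $G$ it stabilizes, and its final term is the hypercenter $Z_\infty(G)$. For a finite solvable group $G$ and a subset $\pi$ of the set of prime divisors of $|G|$, a Hall $\pi$-subgroup of $G$ is a subgroup whose order is divisible only by primes in $\pi$ and whose index is divisible only by primes outside $\pi$. A Hall system $\mathcal H$ of $G$ consists of one Hall $\pi$-subgroup for each subset $\pi$ of the set of prime divisors of $|G|$, such that every two members $K_1,K_2$ permute as subgroups ($K_1K_2=K_2K_1$). The system normalizer of $\mathcal H$ is $D(\mathcal H)=\bigcap_{K\in\mathcal H}\operatorname{N}_G(K)$, where $\operatorname{N}_G(K)=\{g\in G: g^{-1}Kg=K\}$. A system normalizer of $G$ is a subgroup of the form $D(\mathcal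 H)$ for some Hall system $\mathcal H$ of $G$. *)

theory Defs
  imports "HOL-Algebra.Algebra" "HOL-Number_Theory.Prime_Powers"
begin

definition metabelian :: "('a, 'b) monoid_scheme \<Rightarrow> bool" where
  "metabelian G \<longleftrightarrow> group G \<and> comm_group (G\<lparr>carrier := derived G (carrier G)\<rparr>)"

definition maximal_subgroup :: "'a set \<Rightarrow> ('a, 'b) monoid_scheme \<Rightarrow> bool" where
  "maximal_subgroup M G \<longleftrightarrow> subgroup M G \<and> M \<noteq> carrier G \<and>
     (\<forall>H. subgroup H G \<longrightarrow> M \<subseteq> H \<longrightarrow> H = M \<or> H = carrier G)"

(* Intersecting with the carrier gives the usual value for the trivial group,
   which has no maximal subgroups. *)
definition frattini :: "('a, 'b) monoid_scheme \<Rightarrow> 'a set" where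
  "frattini G = carrier G \<inter> \<Inter>{M. maximal_subgroup M G}"

definition group_center :: "('a, 'b) monoid_scheme \<Rightarrow> 'a set" where
  "group_center G = {z \<in> carrier G. \<forall>x\<in>carrier G. x \<otimes>\<^bsub>G\<^esub> z = z \<otimes>\<^bsub>G\<^esub> x}"

(* Each term is the full preimage in G of the center of the quotient by the previous one. *)
primrec upper_central :: "('a, 'b) monoid_scheme \<Rightarrow> nat \<Rightarrow> 'a set" where
  "upper_central G 0 = {\<one>\<^bsub>G\<^esub>}"
| "upper_central G (Suc i) =
     {x \<in> carrier G. upper_central G i #>\<^bsub>G\<^esub> x \<in> group_center (G Mod upper_central G i)}"

(* The value at which the upper central series stabilizes; meaningful when it does,
   in particular for every finite group. *)
definition hypercenter :: "('a, 'b) monoid_scheme \<Rightarrow> 'a set" where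
  "hypercenter G =
     upper_central G (LEAST n. \<forall>k\<ge>n. upper_central G k = upper_central G n)"

(* For finite G. *)
definition hall_subgroup :: "('a, 'b) monoid_scheme \<Rightarrow> nat set \<Rightarrow> 'a set \<Rightarrow> bool" where
  "hall_subgroup G \<pi> K \<longleftrightarrow> subgroup K G \<and>
     prime_factors (card K) \<subseteq> \<pi> \<and> prime_factors (card (rcosets\<^bsub>G\<^esub> K)) \<inter> \<pi> = {}"

(* A Hall system is given as a family indexed by the sets of prime divisors of the group order;
   its values at other index sets are irrelevant. *)
definition hall_system :: "('a, 'b) monoid_scheme \<Rightarrow> (nat set \<Rightarrow> 'a set) \<Rightarrow> bool" where
  "hall_system G \<H> \<longleftrightarrow>
     (\<forall>\<pi>. \<pi> \<subseteq> prime_factors (order G) \<longrightarrow> hall_subgroup G \<pi> (\<H> \<pi>)) \<and>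
     (\<forall>\<pi> \<rho>. \<pi> \<subseteq> prime_factors (order G) \<longrightarrow> \<rho> \<subseteq> prime_factors (order G) \<longrightarrow>
        \<H> \<pi> <#>\<^bsub>G\<^esub> \<H> \<rho> = \<H> \<rho> <#>\<^bsub>G\<^esub> \<H> \<pi>)"

definition hall_system_normalizer ::
  "('a, 'b) monoid_scheme \<Rightarrow> (nat set \<Rightarrow> 'a set) \<Rightarrow> 'a set" where
  "hall_system_normalizer G \<H> = (\<Inter>\<pi>\<in>Pow (prime_factors (order G)). normalizer G (\<H> \<pi>))"

definition system_normalizers :: "('a, 'b) monoid_scheme \<Rightarrow> 'a set set" where
  "system_normalizers G = {hall_system_normalizer G \<H> | \<H>. hall_system G \<H>}"

definition hypercenter_family :: "('a, 'b) monoid_scheme \<Rightarrow> 'a set set \<Rightarrow> bool" where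
  "hypercenter_family G \<D> \<longleftrightarrow> \<D> \<subseteq> system_normalizers G \<and> finite \<D> \<and> \<D> \<noteq> {} \<and>
     \<Inter>\<D> = hypercenter G"

(* A relation rather than a value, so that it also asserts that such a family exists. *)
definition least_system_normalizer_number :: "('a, 'b) monoid_scheme \<Rightarrow> nat \<Rightarrow> bool" where
  "least_system_normalizer_number G n \<longleftrightarrow>
     (\<exists>\<D>. hypercenter_family G \<D> \<and> card \<D> = n) \<and>
     (\<forall>\<D>. hypercenter_family G \<D> \<longrightarrow> n \<le> card \<D>)"

end

theory Submission
  imports Defs
begin

text \<open>
  Let $q = p^k$ and let $V = \mathbb{F}_p^k$. Put $Z = V$, $B = V^m$, let $A$ be elementary abelian of order $q^m$, and
  let $\omega : A \<times> B \<rightarrow> Z$ be a biadditive pairing with two properties: every element of $Z$ is a value of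
  $\omega$, and there are $\alpha_0, \ldots, \alpha_{m-1} \<in> A$ with trivial common annihilator in $B$. Such a pairing is
  already available over the prime field: let some $m$ coordinates of $a$ be the coefficients of a linear combination
  of the $m$ components of $b$. Let $B$ act on $N = A \<times> Z$ by $(a, z) \<mapsto> (a, z + \omega(a, b))$, and let an
  involution $t$ invert $N$ and centralize $B$. The group is $G = N \<rtimes> (B \<times> \<langle>t\<rangle>)$, of order $2q^{2m+1}$.

  Its commutator subgroup lies in the abelian group $N$. As $t$ inverts $N$, the center consists of the elements of $B$
  that act trivially, and the second center is no larger; so the hypercenter is trivial here
  (\<open>hypercenter_eq\<close>, \<open>hypercenter_trivial\<close>). Every element of $Z$ is a commutator of an element of $A$ and one of $B$ in
  a way that central corrections do not disturb, which puts $Z$ into every maximal subgroup; subgroups of index $2$ and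
  $p$ cut out nothing more than $Z$ (\<open>frattini_eq\<close>).

  The Sylow $p$-subgroup $NB$ is normal, so a Hall system amounts to the choice of a Sylow $2$-subgroup, that is, of an
  involution, and its normalizer is the centralizer of that involution. The system normalizers are therefore the
  conjugates of $B \<times> \<langle>t\<rangle>$ by elements $h = (a, z)$ of $N$ (\<open>system_normalizers_eq\<close>). Distinct ones share no
  involution, and $b \<in> B$ occurs in the conjugates by $h$ and by $h'$, with the same component in $N$, exactly if
  $\omega(a, b) = \omega(a', b)$. So $m + 1$ conjugates intersect trivially if the differences of their parameters from a
  fixed one have trivial common annihilator in $B$, as is the case for $0, \alpha_0, \ldots, \alpha_{m-1}$; and at most
  $m - 1$ differences always have a common annihilator, because $|B| = q^m > |Z|^{m-1}$ (\<open>family_lower_bound\<close>,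
  \<open>least_number\<close>).

  In $G/Z$ the action of $B$ becomes trivial. The hypercenter is $B$, each system normalizer is $B$ extended by an
  involution, and two different ones meet in $B$ (\<open>least_number_trivial_action\<close>). To treat $G$ and $G/Z$ alike, the
  results on $N \<rtimes> (B \<times> \<langle>t\<rangle>)$ are proved for any group that is described by coordinates in $N$, $B$ and
  $\<langle>t\<rangle>$.
\<close>

section \<open>Groups of odd order, maximal subgroups and normalizers\<close>

text \<open>Squaring is a bijection of a group of odd order, because raising to the power
  $(|G|+1)/2$ undoes it. This makes it possible to divide by two, both in the group that the
  involution inverts and in its centralizer.\<close>

lemma (in group) power_of_square:
  assumes "odd (order G)" and "x \<in> carrier G"
  shows "(x \<otimes> x) [^] ((order G + 1) div 2) = x"
proof -
  define k where "k = (order G + 1) div 2"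
  have k: "2 * k = order G + 1" using assms(1) by (auto simp: k_def elim!: oddE)
  have "x \<otimes> x = x [^] (2::nat)" using assms(2) by (simp add: numeral_2_eq_2 nat_pow_def)
  then have "(x \<otimes> x) [^] k = x [^] (2 * k)" using assms(2) by (simp add: nat_pow_pow)
  also have "\<dots> = x" using assms(2) by (simp add: k pow_order_eq_1)
  finally show ?thesis by (simp add: k_def)
qed

lemma (in group) square_inj:
  assumes "odd (order G)" and "x \<in> carrier G" "y \<in> carrier G" and "x \<otimes> x = y \<otimes> y"
  shows "x = y"
  using power_of_square assms by metis

lemma (in comm_group) square_root:
  assumes "odd (order G)" and "x \<in> carrier G"
  obtains h where "h \<in> carrier G" "h \<otimes> h = x"
proof
  show "x [^] ((order G + 1) div 2) \<in> carrier G" using assms by simp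
  show "x [^] ((order G + 1) div 2) \<otimes> x [^] ((order G + 1) div 2) = x"
    using power_of_square[OF assms] assms(2) by (simp add: nat_pow_distrib)
qed

lemma (in group) finite_closed_subgroup:
  assumes "finite (carrier G)" "H \<subseteq> carrier G" "\<one> \<in> H"
    and closed: "\<And>x y. \<lbrakk>x \<in> H; y \<in> H\<rbrakk> \<Longrightarrow> x \<otimes> y \<in> H"
  shows "subgroup H G"
proof (rule subgroupI)
  fix x assume x: "x \<in> H"
  then have xG: "x \<in> carrier G" using assms by blast
  have pow: "x [^] (k::nat) \<in> H" for k using x assms(3) closed by (induction k) auto
  obtain k where k: "order G = Suc k"
    using assms(1) xG by (metis card_0_eq empty_iff not0_implies_Suc order_def)
  have "x [^] k \<otimes> x = \<one>" using pow_order_eq_1[OF xG] by (simp add: k)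
  then have "inv x = x [^] k" using xG by (simp add: inv_equality)
  then show "inv x \<in> H" using pow by simp
qed (use assms in auto)

lemma (in comm_group) quotient_swap:
  assumes "x \<otimes> inv y = x' \<otimes> inv y'"
    and [simp]: "x \<in> carrier G" "y \<in> carrier G" "x' \<in> carrier G" "y' \<in> carrier G"
  shows "x \<otimes> inv x' = y \<otimes> inv y'"
proof -
  have "x \<otimes> inv x' = x \<otimes> (inv y \<otimes> y) \<otimes> inv x'" by simp
  also have "\<dots> = (x \<otimes> inv y) \<otimes> (y \<otimes> inv x')" by (simp only: m_assoc m_closed inv_closed assms(2-5))
  also have "\<dots> = (x' \<otimes> inv x') \<otimes> (y \<otimes> inv y')" unfolding assms(1) by (simp only: m_ac m_closed inv_closed assms(2-5))
  finally show ?thesis by simp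
qed

lemma (in group) prime_index_maximal:
  assumes "finite (carrier G)" and M: "subgroup M G" and p: "Factorial_Ring.prime p" "card M * p = order G"
  shows "maximal_subgroup M G"
  unfolding maximal_subgroup_def
proof (intro conjI allI impI M)
  have fin: "card M \<noteq> 0" using assms(1) M
    by (metis card_0_eq empty_iff finite_subset subgroup.one_closed subgroup.subset)
  then show "M \<noteq> carrier G" using p(2) prime_gt_1_nat[OF p(1)] by (auto simp: order_def)
  fix H assume H: "subgroup H G" "M \<subseteq> H"
  interpret H: group "G\<lparr>carrier := H\<rparr>" by (rule subgroup_imp_group[OF H(1)])
  have fH: "finite H" using assms(1) H(1) by (meson finite_subset subgroup.subset)
  have 1: "card M dvd card H"
    using H.lagrange[OF subgroup_incl[OF M H]] by (simp add: order_def) (metis dvd_triv_right)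
  then obtain c where c: "card H = card M * c" by blast
  have "card H dvd order G" using lagrange[OF H(1)] by (metis dvd_triv_right)
  then have "c dvd p" using fin by (auto simp: c p(2)[symmetric])
  then have "c = 1 \<or> c = p" using p(1) prime_nat_iff by blast
  then show "H = M \<or> H = carrier G"
  proof
    assume "c = 1"
    then have "card M = card H" using c by simp
    then show ?thesis using card_subset_eq[OF fH H(2)] by simp
  next
    assume "c = p"
    then have "card H = card (carrier G)" using c p(2) by (simp add: order_def)
    then show ?thesis using H(1) assms(1) card_subset_eq subgroup.subset by metis
  qed
qed

lemma (in group) normal_normalizer:
  assumes "K \<lhd> G"
  shows "normalizer G K = carrier G"
proof -
  interpret K: normal K G by fact
  have "x <# K #> inv x = K" if x: "x \<in> carrier G" for x
  proof -
    have "x <# K = K #> x" using K.coset_eq x by simp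
    then show ?thesis using x by (simp add: coset_mult_assoc K.subset)
  qed
  then show ?thesis by (auto simp: normalizer_def stabilizer_def K.subset)
qed

lemma (in group) normalizer_involution:
  assumes t: "t \<in> carrier G" "t \<noteq> \<one>"
  shows "normalizer G {\<one>, t} = {x \<in> carrier G. x \<otimes> t = t \<otimes> x}"
proof -
  have "x <# {\<one>, t} #> inv x = {\<one>, t} \<longleftrightarrow> x \<otimes> t = t \<otimes> x" if x: "x \<in> carrier G" for x
  proof -
    have 1: "x <# {\<one>, t} #> inv x = {\<one>, x \<otimes> t \<otimes> inv x}"
      using x t by (auto simp: l_coset_def r_coset_def)
    have "x \<otimes> t \<otimes> inv x = t \<longleftrightarrow> x \<otimes> t = t \<otimes> x"
      using x t by (metis inv_solve_right m_closed inv_closed)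
    moreover have "x \<otimes> t \<otimes> inv x = \<one> \<Longrightarrow> x \<otimes> t = x"
      using x t by (metis inv_solve_right l_one m_closed one_closed)
    ultimately show ?thesis using x t by (auto simp: 1 doubleton_eq_iff)
  qed
  then show ?thesis using t by (auto simp: normalizer_def stabilizer_def)
qed

text \<open>A term of the upper central series is thereby described by commutation up to the
  previous term, without any computation in the quotient.\<close>

lemma (in group) center_preimage:
  assumes "H \<lhd> G" 
  shows "{x \<in> carrier G. H #> x \<in> group_center (G Mod H)} =
    {x \<in> carrier G. \<forall>y \<in> carrier G. x \<otimes> y \<in> H #> (y \<otimes> x)}"
proof -
  interpret H: normal H G by fact
  have "H #> (x \<otimes> y) = H #> (y \<otimes> x) \<longleftrightarrow> x \<otimes> y \<in> H #> (y \<otimes> x)"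
    if "x \<in> carrier G" "y \<in> carrier G" for x y
    using that repr_independence[of "x \<otimes> y" H "y \<otimes> x"] repr_independenceD[of H "x \<otimes> y" "y \<otimes> x"]
      H.is_subgroup by auto
  then have "H #> (y \<otimes> x) = H #> (x \<otimes> y) \<longleftrightarrow> x \<otimes> y \<in> H #> (y \<otimes> x)"
    if "x \<in> carrier G" "y \<in> carrier G" for x y
    using that by metis
  then have "(\<forall>y \<in> carrier G. H #> (y \<otimes> x) = H #> (x \<otimes> y)) \<longleftrightarrow>
      (\<forall>y \<in> carrier G. x \<otimes> y \<in> H #> (y \<otimes> x))" if "x \<in> carrier G" for x
    using that by metis
  then show ?thesis
    by (simp add: group_center_def carrier_FactGroup H.rcos_sum cong: conj_cong)
qed

text \<open>For a group of order $2p^t$ a Hall subgroup is recognised by its order alone.\<close>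

lemma split_prime_powers:
  fixes p t c d :: nat
  assumes "Factorial_Ring.prime p" "odd p" "t > 0" "c * d = 2 * p ^ t" "\<pi> \<subseteq> {2, p}"
  shows "prime_factors c \<subseteq> \<pi> \<and> prime_factors d \<inter> \<pi> = {} \<longleftrightarrow>
    c = (if 2 \<in> \<pi> then 2 else 1) * (if p \<in> \<pi> then p ^ t else 1)"
proof -
  have p2: "p \<noteq> 2" using assms(2) by auto
  have *: "\<exists>i j. e = 2 ^ i * p ^ j" if dvd: "e dvd 2 * p ^ t" for e
  proof -
    obtain e1 e2 where e: "e = e1 * e2" "e1 dvd 2" "e2 dvd p ^ t" using division_decomp[OF dvd] by blast
    have "e1 dvd 2 ^ 1" using e by simp
    then obtain i where "e1 = 2 ^ i" using divides_primepow_nat[of 2 e1 1] two_is_prime_nat by blast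
    moreover obtain j where "e2 = p ^ j" using divides_primepow_nat[OF assms(1)] e by blast
    ultimately show ?thesis using e by blast
  qed
  obtain i j where c: "c = 2 ^ i * p ^ j" using *[of c] assms(4) by (metis dvd_triv_left)
  obtain i' j' where d: "d = 2 ^ i' * p ^ j'" using *[of d] assms(4) by (metis dvd_triv_right)
  have m2: "multiplicity 2 (2 ^ a * p ^ b) = a" and mp: "multiplicity p (2 ^ a * p ^ b) = b" for a b
    using p2 prime_multiplicity_other[OF two_is_prime_nat assms(1)]
      prime_multiplicity_other[OF assms(1) two_is_prime_nat] assms(1) two_is_prime_nat
    by (auto simp: prime_elem_multiplicity_mult_distrib prime_elem_multiplicity_power_distrib prime_gt_0_nat)
  have cd: "2 ^ (i + i') * p ^ (j + j') = 2 ^ 1 * p ^ t"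
    using assms(4) by (simp add: c d power_add algebra_simps)
  have ii: "i + i' = 1" using arg_cong[OF cd, of "multiplicity 2"] by (simp only: m2)
  have jj: "j + j' = t" using arg_cong[OF cd, of "multiplicity p"] by (simp only: mp)
  have pf: "prime_factors (2 ^ a * p ^ b) = (if a = 0 then {} else {2}) \<union> (if b = 0 then {} else {p})" for a b
    using assms(1) two_is_prime_nat
    by (simp add: prime_factors_product prime_factorization_prime_power set_mset_replicate_mset_subset
        prime_gt_0_nat)
  have eq: "2 ^ i * p ^ j = 2 ^ a * p ^ b \<longleftrightarrow> i = a \<and> j = b" for a b
    using m2 mp by metis
  have w: "(if 2 \<in> \<pi> then 2 else 1) * (if p \<in> \<pi> then p ^ t else 1) =
     2 ^ (if 2 \<in> \<pi> then 1 else 0) * p ^ (if p \<in> \<pi> then t else 0)" by auto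
  show ?thesis unfolding w unfolding c d pf eq
    using ii jj assms(3,5) p2 by auto
qed

section \<open>Extensions by an inverting involution\<close>

text \<open>The action on an abelian group $N$ of the group of order two that inverts $N$; a truth
  value tells whether the nontrivial element acts.\<close>

definition twist :: "('n, 'm) monoid_scheme \<Rightarrow> bool \<Rightarrow> 'n \<Rightarrow> 'n" where
  "twist N e n = (if e then inv\<^bsub>N\<^esub> n else n)"

text \<open>Two abelian $p$-groups for an odd prime $p$, the second acting on the first. Inversion of
  $N$ commutes with this action, so that $B \<times> C_2$ acts on $N$.\<close>

locale inverted_action = N: comm_group N + B: comm_group B
  for N :: "'n monoid" and B :: "'b monoid" +
  fixes act :: "'b \<Rightarrow> 'n \<Rightarrow> 'n" and p r s :: nat
  assumes prime: "Factorial_Ring.prime p" and odd: "odd p"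
    and order_N: "order N = p ^ r" and r_pos: "r > 0" and order_B: "order B = p ^ s"
    and act_closed [simp]: "\<lbrakk>b \<in> carrier B; n \<in> carrier N\<rbrakk> \<Longrightarrow> act b n \<in> carrier N"
    and act_mult: "\<lbrakk>b \<in> carrier B; n \<in> carrier N; n' \<in> carrier N\<rbrakk>
      \<Longrightarrow> act b (n \<otimes>\<^bsub>N\<^esub> n') = act b n \<otimes>\<^bsub>N\<^esub> act b n'"
    and act_act: "\<lbrakk>b \<in> carrier B; b' \<in> carrier B; n \<in> carrier N\<rbrakk>
      \<Longrightarrow> act (b \<otimes>\<^bsub>B\<^esub> b') n = act b (act b' n)"
    and act_id [simp]: "n \<in> carrier N \<Longrightarrow> act \<one>\<^bsub>B\<^esub> n = n"
begin

lemma twist_closed [simp]: "n \<in> carrier N \<Longrightarrow> twist N e n \<in> carrier N"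
  by (simp add: twist_def)

lemma act_hom: "b \<in> carrier B \<Longrightarrow> group_hom N N (act b)"
  by (intro group_hom.intro group_hom_axioms.intro N.group_axioms homI) (auto simp: act_mult)

lemma act_one [simp]: "b \<in> carrier B \<Longrightarrow> act b \<one>\<^bsub>N\<^esub> = \<one>\<^bsub>N\<^esub>"
  using act_hom group_hom.hom_one by metis

lemma act_inv: "\<lbrakk>b \<in> carrier B; n \<in> carrier N\<rbrakk> \<Longrightarrow> act b (inv\<^bsub>N\<^esub> n) = inv\<^bsub>N\<^esub> act b n"
  using act_hom group_hom.hom_inv by metis

lemma twist_one [simp]: "twist N e \<one>\<^bsub>N\<^esub> = \<one>\<^bsub>N\<^esub>"
  by (simp add: twist_def)

lemma finite_N [simp]: "finite (carrier N)" and finite_B [simp]: "finite (carrier B)"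
  using order_N order_B prime prime_gt_0_nat[OF prime]
  by (metis order_def card.infinite less_irrefl zero_less_power)+

lemma odd_N: "odd (order N)" and odd_B: "odd (order B)"
  using odd by (simp_all add: order_N order_B)

text \<open>The group $N \<rtimes> (B \<times> C_2)$; in a triple the truth value records whether
  the involution occurs.\<close>

definition semidirect :: "('n \<times> 'b \<times> bool) monoid" where
  "semidirect = \<lparr>carrier = carrier N \<times> carrier B \<times> UNIV,
     monoid.mult = (\<lambda>(n, b, e) (n', b', e'). (n \<otimes>\<^bsub>N\<^esub> twist N e (act b n'), b \<otimes>\<^bsub>B\<^esub> b', e \<noteq> e')),
     monoid.one = (\<one>\<^bsub>N\<^esub>, \<one>\<^bsub>B\<^esub>, False)\<rparr>"

lemma semidirect_group: "group semidirect"
proof (rule groupI)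
  fix x y z assume "x \<in> carrier semidirect" "y \<in> carrier semidirect" "z \<in> carrier semidirect"
  then show "x \<otimes>\<^bsub>semidirect\<^esub> y \<otimes>\<^bsub>semidirect\<^esub> z = x \<otimes>\<^bsub>semidirect\<^esub> (y \<otimes>\<^bsub>semidirect\<^esub> z)"
    by (auto simp: semidirect_def twist_def act_mult act_act act_inv N.inv_mult N.m_assoc B.m_assoc)
next
  fix x assume "x \<in> carrier semidirect"
  then obtain n b e where x: "x = (n, b, e)" "n \<in> carrier N" "b \<in> carrier B" by (auto simp: semidirect_def)
  have "(twist N e (act (inv\<^bsub>B\<^esub> b) (inv\<^bsub>N\<^esub> n)), inv\<^bsub>B\<^esub> b, e) \<otimes>\<^bsub>semidirect\<^esub> x = \<one>\<^bsub>semidirect\<^esub>"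
    using x by (simp add: semidirect_def twist_def act_inv)
  then show "\<exists>y\<in>carrier semidirect. y \<otimes>\<^bsub>semidirect\<^esub> x = \<one>\<^bsub>semidirect\<^esub>"
    using x by (intro bexI[of _ "(twist N e (act (inv\<^bsub>B\<^esub> b) (inv\<^bsub>N\<^esub> n)), inv\<^bsub>B\<^esub> b, e)"])
      (auto simp: semidirect_def)
qed (auto simp: semidirect_def twist_def)

end

text \<open>A group $G$ with coordinates that identify it with $N \<rtimes> (B \<times> C_2)$.
  Fixing an arbitrary group with a coordinate map, instead of the group of triples itself, lets the same results
  apply to a group of natural numbers and to the Frattini quotient of that group, whose elements are cosets.\<close>

locale inverted_extension = inverted_action N B act p r s + G: group G
  for N :: "'n monoid" and B :: "'b monoid" and act and p r s :: nat and G :: "'g monoid" +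
  fixes mk :: "'n \<Rightarrow> 'b \<Rightarrow> bool \<Rightarrow> 'g"
  assumes carrier_G: "carrier G = {mk n b e | n b e. n \<in> carrier N \<and> b \<in> carrier B}"
    and mk_eq: "\<lbrakk>n \<in> carrier N; b \<in> carrier B; n' \<in> carrier N; b' \<in> carrier B\<rbrakk>
      \<Longrightarrow> mk n b e = mk n' b' e' \<longleftrightarrow> n = n' \<and> b = b' \<and> e = e'"
    and mk_mult: "\<lbrakk>n \<in> carrier N; b \<in> carrier B; n' \<in> carrier N; b' \<in> carrier B\<rbrakk>
      \<Longrightarrow> mk n b e \<otimes>\<^bsub>G\<^esub> mk n' b' e' =
          mk (n \<otimes>\<^bsub>N\<^esub> twist N e (act b n')) (b \<otimes>\<^bsub>B\<^esub> b') (e \<noteq> e')"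
begin

lemma mk_in [simp]: "\<lbrakk>n \<in> carrier N; b \<in> carrier B\<rbrakk> \<Longrightarrow> mk n b e \<in> carrier G"
  by (auto simp: carrier_G)

lemma mk_cases:
  assumes "x \<in> carrier G"
  obtains n b e where "x = mk n b e" "n \<in> carrier N" "b \<in> carrier B"
  using assms by (auto simp: carrier_G)

lemma one_G: "\<one>\<^bsub>G\<^esub> = mk \<one>\<^bsub>N\<^esub> \<one>\<^bsub>B\<^esub> False"
proof -
  let ?o = "mk \<one>\<^bsub>N\<^esub> \<one>\<^bsub>B\<^esub> False"
  have "?o \<otimes>\<^bsub>G\<^esub> ?o = ?o" by (simp add: mk_mult)
  then show ?thesis using G.r_cancel_one[of ?o ?o] by simp
qed

lemma carrier_G_image: "carrier G = (\<lambda>(n, b, e). mk n b e) ` (carrier N \<times> carrier B \<times> UNIV)"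
  by (force simp: carrier_G)

lemma mk_inj_on: "inj_on (\<lambda>(n, b, e). mk n b e) (carrier N \<times> carrier B \<times> UNIV)"
  by (auto simp: inj_on_def mk_eq)

lemma finite_G [simp]: "finite (carrier G)"
  by (simp add: carrier_G_image)

lemma card_mk:
  assumes "K \<subseteq> carrier N" "L \<subseteq> carrier B"
  shows "card {mk n b e | n b e. n \<in> K \<and> b \<in> L \<and> e \<in> E} = card K * card L * card E"
proof -
  have "{mk n b e | n b e. n \<in> K \<and> b \<in> L \<and> e \<in> E} = (\<lambda>(n, b, e). mk n b e) ` (K \<times> L \<times> E)"
    by force
  moreover have "inj_on (\<lambda>(n, b, e). mk n b e) (K \<times> L \<times> E)"
    by (rule inj_on_subset[OF mk_inj_on]) (use assms in auto)
  ultimately show ?thesis by (simp add: card_image card_cartesian_product)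
qed

lemma order_G: "order G = 2 * p ^ (r + s)"
  using card_mk[of "carrier N" "carrier B" UNIV] order_N order_B
  by (simp add: order_def carrier_G power_add card_UNIV_bool)

end

lemma (in inverted_action) extension_on_nat:
  obtains G :: "nat monoid" and mk where "inverted_extension N B act p r s G mk"
proof -
  let ?C = "carrier semidirect"
  interpret S: group semidirect by (rule semidirect_group)
  have "finite ?C" by (simp add: semidirect_def)
  then obtain f :: "'n \<times> 'b \<times> bool \<Rightarrow> nat" where f: "inj_on f ?C"
    using finite_imp_inj_to_nat_seg by blast
  define g where "g = inv_into ?C f"
  have gf [simp]: "g (f x) = x" if "x \<in> ?C" for x using f that by (simp add: g_def)
  define G where "G = \<lparr>carrier = f ` ?C, monoid.mult = (\<lambda>x y. f (g x \<otimes>\<^bsub>semidirect\<^esub> g y)),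
    monoid.one = f \<one>\<^bsub>semidirect\<^esub>\<rparr>"
  have "group G"
  proof (rule groupI)
    fix x assume "x \<in> carrier G"
    then obtain u where "x = f u" "u \<in> ?C" by (auto simp: G_def)
    then show "\<exists>y\<in>carrier G. y \<otimes>\<^bsub>G\<^esub> x = \<one>\<^bsub>G\<^esub>"
      by (intro bexI[of _ "f (inv\<^bsub>semidirect\<^esub> u)"]) (auto simp: G_def)
  qed (auto simp: G_def S.m_assoc)
  moreover have "carrier G = {f (n, b, e) | n b e. n \<in> carrier N \<and> b \<in> carrier B}"
    by (force simp: G_def semidirect_def)
  moreover have "f (n, b, e) = f (n', b', e') \<longleftrightarrow> n = n' \<and> b = b' \<and> e = e'"
    if "n \<in> carrier N" "b \<in> carrier B" "n' \<in> carrier N" "b' \<in> carrier B" for n b e n' b' e'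
    using inj_onD[OF f, of "(n, b, e)" "(n', b', e')"] that by (auto simp: semidirect_def)
  moreover have "f (n, b, e) \<otimes>\<^bsub>G\<^esub> f (n', b', e') =
      f (n \<otimes>\<^bsub>N\<^esub> twist N e (act b n'), b \<otimes>\<^bsub>B\<^esub> b', e \<noteq> e')"
    if "n \<in> carrier N" "b \<in> carrier B" "n' \<in> carrier N" "b' \<in> carrier B" for n b e n' b' e'
  proof -
    have "(n, b, e) \<in> ?C" "(n', b', e') \<in> ?C" using that by (auto simp: semidirect_def)
    then have "f (n, b, e) \<otimes>\<^bsub>G\<^esub> f (n', b', e') = f ((n, b, e) \<otimes>\<^bsub>semidirect\<^esub> (n', b', e'))"
      by (simp add: G_def)
    then show ?thesis by (simp add: semidirect_def)
  qed
  ultimately have "inverted_extension N B act p r s G (\<lambda>n b e. f (n, b, e))"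
    by (intro inverted_extension.intro inverted_extension_axioms.intro inverted_action_axioms)
  then show thesis by (rule that)
qed

section \<open>Hypercenter and commutator subgroup\<close>

context inverted_extension begin

lemma inv_mk:
  assumes "n \<in> carrier N" "b \<in> carrier B"
  obtains n' where "n' \<in> carrier N" "inv\<^bsub>G\<^esub> mk n b e = mk n' (inv\<^bsub>B\<^esub> b) e"
proof -
  have x: "mk n b e \<in> carrier G" using assms by simp
  obtain n' b' e' where y: "inv\<^bsub>G\<^esub> mk n b e = mk n' b' e'" "n' \<in> carrier N" "b' \<in> carrier B"
    using mk_cases[OF G.inv_closed[OF x]] by metis
  have "mk n b e \<otimes>\<^bsub>G\<^esub> mk n' b' e' = \<one>\<^bsub>G\<^esub>" using x y by (metis G.r_inv)
  then have "b \<otimes>\<^bsub>B\<^esub> b' = \<one>\<^bsub>B\<^esub>" "e = e'" using assms y by (auto simp: mk_mult one_G mk_eq)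
  then have "b' = inv\<^bsub>B\<^esub> b" using assms y by (metis B.inv_equality B.m_comm)
  with that y \<open>e = e'\<close> show thesis by blast
qed

definition act_kernel :: "'b set" where
  "act_kernel = {b \<in> carrier B. \<forall>n \<in> carrier N. act b n = n}"

definition central :: "'g set" where
  "central = {mk \<one>\<^bsub>N\<^esub> b False | b. b \<in> act_kernel}"

text \<open>As $B$ has odd order, $b$ is a power of $b^2$.\<close>

lemma act_kernel_square:
  assumes b: "b \<in> carrier B" and bb: "b \<otimes>\<^bsub>B\<^esub> b \<in> act_kernel"
  shows "b \<in> act_kernel"
proof -
  have "act ((b \<otimes>\<^bsub>B\<^esub> b) [^]\<^bsub>B\<^esub> k) n = n" if "n \<in> carrier N" for k :: nat and n
    using that bb b by (induction k) (auto simp: act_act act_kernel_def)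
  from this[of _ "(order B + 1) div 2"] show ?thesis
    using B.power_of_square[OF odd_B b] b by (simp add: act_kernel_def)
qed

lemma central_commutes:
  assumes "x \<in> central" "y \<in> carrier G"
  shows "x \<otimes>\<^bsub>G\<^esub> y = y \<otimes>\<^bsub>G\<^esub> x"
proof -
  obtain b where x: "x = mk \<one>\<^bsub>N\<^esub> b False" "b \<in> carrier B" "\<forall>n \<in> carrier N. act b n = n"
    using assms(1) by (auto simp: central_def act_kernel_def)
  obtain n c e where y: "y = mk n c e" "n \<in> carrier N" "c \<in> carrier B"
    using mk_cases[OF assms(2)] .
  show ?thesis using x y by (auto simp: mk_mult B.m_comm twist_def)
qed

lemma central_subgroup: "subgroup central G"
proof (rule G.subgroupI)
  show "central \<subseteq> carrier G" by (auto simp: central_def act_kernel_def)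
  show "central \<noteq> {}" by (auto simp: central_def act_kernel_def)
next
  fix x assume "x \<in> central"
  then obtain b where x: "x = mk \<one>\<^bsub>N\<^esub> b False" "b \<in> carrier B" "\<forall>n \<in> carrier N. act b n = n"
    by (auto simp: central_def act_kernel_def)
  have a: "act (inv\<^bsub>B\<^esub> b) n = n" if "n \<in> carrier N" for n
    using act_act[of "inv\<^bsub>B\<^esub> b" b n] x that by simp
  have "mk \<one>\<^bsub>N\<^esub> (inv\<^bsub>B\<^esub> b) False \<otimes>\<^bsub>G\<^esub> x = \<one>\<^bsub>G\<^esub>" using x by (simp add: mk_mult one_G twist_def)
  then have "inv\<^bsub>G\<^esub> x = mk \<one>\<^bsub>N\<^esub> (inv\<^bsub>B\<^esub> b) False" using x by (simp add: G.inv_equality)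
  with a x show "inv\<^bsub>G\<^esub> x \<in> central" by (auto simp: central_def act_kernel_def)
next
  fix x y assume "x \<in> central" "y \<in> central"
  then obtain b c where x: "x = mk \<one>\<^bsub>N\<^esub> b False" "b \<in> carrier B" "\<forall>n \<in> carrier N. act b n = n"
     and y: "y = mk \<one>\<^bsub>N\<^esub> c False" "c \<in> carrier B" "\<forall>n \<in> carrier N. act c n = n"
    by (auto simp: central_def act_kernel_def)
  then show "x \<otimes>\<^bsub>G\<^esub> y \<in> central"
    by (auto simp: central_def act_kernel_def mk_mult act_act twist_def intro!: exI[of _ "b \<otimes>\<^bsub>B\<^esub> c"])
qed

text \<open>Modulo central elements, an element $(n, b, e)$ that commutes with the involution
  satisfies $n = n^{-1}$, hence $n = 1$. If it also commutes with all of $N$, then the action of $b$, followed by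
  inversion in case $e$ holds, is trivial on $N$. In that case $b^2$ and hence $b$ acts trivially, so that inversion
  is trivial on $N$, contrary to $N \<noteq> 1$.

  The preimage of the center is thus the same subgroup for the trivial subgroup and for the center itself: the upper
  central series is stationary from its first term on.\<close>

lemma central_modulo_central:
  assumes H: "subgroup H G" "H \<subseteq> central"
  shows "{x \<in> carrier G. H #>\<^bsub>G\<^esub> x \<in> group_center (G Mod H)} = central"
proof -
  have "H \<lhd> G"
  proof (rule G.normal_invI[OF H(1)])
    fix x h assume x: "x \<in> carrier G" and h: "h \<in> H"
    then have "x \<otimes>\<^bsub>G\<^esub> h \<otimes>\<^bsub>G\<^esub> inv\<^bsub>G\<^esub> x = h \<otimes>\<^bsub>G\<^esub> x \<otimes>\<^bsub>G\<^esub> inv\<^bsub>G\<^esub> x"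
      using H central_commutes[of h x] by auto
    also have "\<dots> = h" using x h H(1) by (simp add: G.m_assoc subgroup.mem_carrier)
    finally show "x \<otimes>\<^bsub>G\<^esub> h \<otimes>\<^bsub>G\<^esub> inv\<^bsub>G\<^esub> x \<in> H" using h by simp
  qed
  note eq = G.center_preimage[OF this]
  show ?thesis unfolding eq
  proof (intro equalityI subsetI)
    fix x assume x: "x \<in> central"
    then show "x \<in> {x \<in> carrier G. \<forall>y\<in>carrier G. x \<otimes>\<^bsub>G\<^esub> y \<in> H #>\<^bsub>G\<^esub> (y \<otimes>\<^bsub>G\<^esub> x)}"
      using central_subgroup central_commutes[OF x] G.rcos_self[OF _ H(1)] subgroup.mem_carrier by fastforce
  next
    fix x assume "x \<in> {x \<in> carrier G. \<forall>y\<in>carrier G. x \<otimes>\<^bsub>G\<^esub> y \<in> H #>\<^bsub>G\<^esub> (y \<otimes>\<^bsub>G\<^esub> x)}"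
    then have x: "x \<in> carrier G"
      and comm_H: "\<And>y. y \<in> carrier G \<Longrightarrow> x \<otimes>\<^bsub>G\<^esub> y \<in> H #>\<^bsub>G\<^esub> (y \<otimes>\<^bsub>G\<^esub> x)" by auto
    have comm: "\<exists>h \<in> central. x \<otimes>\<^bsub>G\<^esub> y = h \<otimes>\<^bsub>G\<^esub> (y \<otimes>\<^bsub>G\<^esub> x)" if "y \<in> carrier G" for y
      using comm_H[OF that] H(2) by (auto simp: r_coset_def)
    obtain n b e where nbe: "x = mk n b e" "n \<in> carrier N" "b \<in> carrier B" using mk_cases[OF x] .
    have c: "\<exists>c \<in> act_kernel. x \<otimes>\<^bsub>G\<^esub> mk m \<one>\<^bsub>B\<^esub> f = mk \<one>\<^bsub>N\<^esub> c False \<otimes>\<^bsub>G\<^esub> (mk m \<one>\<^bsub>B\<^esub> f \<otimes>\<^bsub>G\<^esub> x)"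
      if "m \<in> carrier N" for m f
      using comm[of "mk m \<one>\<^bsub>B\<^esub> f"] that by (auto simp: central_def)
    \<comment> \<open>Take for $y$ the standard involution.\<close>
    have "n = inv\<^bsub>N\<^esub> n"
      using c[of "\<one>\<^bsub>N\<^esub>" True] nbe
      by (auto simp: act_kernel_def mk_mult mk_eq twist_def[of N True] twist_def[of N False])
    then have "n \<otimes>\<^bsub>N\<^esub> n = \<one>\<^bsub>N\<^esub> \<otimes>\<^bsub>N\<^esub> \<one>\<^bsub>N\<^esub>" using nbe by (metis N.l_one N.one_closed N.r_inv)
    then have n: "n = \<one>\<^bsub>N\<^esub>" using N.square_inj[OF odd_N] nbe by blast
    \<comment> \<open>Take for $y$ an element of $N$.\<close>
    have tw: "twist N e (act b m) = m" if "m \<in> carrier N" for m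
      using c[OF that, of False] nbe n that by (auto simp: act_kernel_def mk_mult mk_eq twist_def[of N False])
    have e: "\<not> e"
    proof
      assume e
      then have a: "act b m = inv\<^bsub>N\<^esub> m" if "m \<in> carrier N" for m
        using tw[OF that] nbe that by (simp add: twist_def) (metis N.inv_inv act_closed)
      then have "b \<otimes>\<^bsub>B\<^esub> b \<in> act_kernel" using nbe by (simp add: act_kernel_def act_act)
      then have "b \<in> act_kernel" using act_kernel_square nbe by blast
      then have "inv\<^bsub>N\<^esub> m = m" if "m \<in> carrier N" for m using a that by (simp add: act_kernel_def)
      then have "m = \<one>\<^bsub>N\<^esub>" if "m \<in> carrier N" for m
        using N.square_inj[OF odd_N, of m "\<one>\<^bsub>N\<^esub>"] that by (metis N.l_one N.one_closed N.r_inv)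
      then have "carrier N = {\<one>\<^bsub>N\<^esub>}" by auto
      then have "order N = 1" by (simp add: order_def)
      then show False using order_N r_pos prime_gt_1_nat[OF prime] by (simp add: one_eq_numeral_iff)
    qed
    then show "x \<in> central" using tw nbe n by (auto simp: central_def act_kernel_def twist_def)
  qed
qed

lemma hypercenter_eq: "hypercenter G = central"
proof -
  (* Index 0 gives the trivial subgroup; from index 1 on the series is constant. *)
  have U: "upper_central G (Suc i) = central" for i
  proof (induction i)
    case 0
    have "{\<one>\<^bsub>G\<^esub>} \<subseteq> central" using central_subgroup by (simp add: subgroup.one_closed)
    then show ?case using central_modulo_central[OF G.triv_subgroup] by simp
  next
    case (Suc i)
    have "upper_central G (Suc (Suc i)) =
      {x \<in> carrier G. upper_central G (Suc i) #>\<^bsub>G\<^esub> x \<in> group_center (G Mod upper_central G (Suc i))}"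
      by (rule upper_central.simps(2))
    also have "\<dots> = central" unfolding Suc using central_modulo_central[OF central_subgroup] by simp
    finally show ?case .
  qed
  let ?P = "\<lambda>n. \<forall>k\<ge>n. upper_central G k = upper_central G n"
  have "?P (Suc 0)" by (metis U Suc_le_D)
  then have "?P (LEAST n. ?P n)" by (rule LeastI)
  then have "upper_central G (Suc (LEAST n. ?P n)) = hypercenter G"
    unfolding hypercenter_def using le_SucI by blast
  then show ?thesis using U by simp
qed

lemma N_subgroup: "subgroup {mk n \<one>\<^bsub>B\<^esub> False | n. n \<in> carrier N} G"
proof (rule G.subgroupI)
  fix x assume "x \<in> {mk n \<one>\<^bsub>B\<^esub> False | n. n \<in> carrier N}"
  then obtain n where n: "x = mk n \<one>\<^bsub>B\<^esub> False" "n \<in> carrier N" by blast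
  obtain n' where "n' \<in> carrier N" "inv\<^bsub>G\<^esub> x = mk n' (inv\<^bsub>B\<^esub> \<one>\<^bsub>B\<^esub>) False"
    using inv_mk[of n "\<one>\<^bsub>B\<^esub>" False] n by auto
  then show "inv\<^bsub>G\<^esub> x \<in> {mk n \<one>\<^bsub>B\<^esub> False | n. n \<in> carrier N}" by auto
qed (auto simp: mk_mult mk_eq twist_def)

text \<open>Both $b$ and $e$ are homomorphic images of $(n, b, e)$ in abelian groups, so commutators lie
  in the abelian group $N$.\<close>

lemma metabelian_G: "metabelian G"
proof -
  let ?N = "{mk n \<one>\<^bsub>B\<^esub> False | n. n \<in> carrier N}"
  have "derived_set G (carrier G) \<subseteq> ?N"
  proof
    fix u assume "u \<in> derived_set G (carrier G)"
    then obtain x y where xy: "x \<in> carrier G" "y \<in> carrier G"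
      "u = x \<otimes>\<^bsub>G\<^esub> y \<otimes>\<^bsub>G\<^esub> inv\<^bsub>G\<^esub> x \<otimes>\<^bsub>G\<^esub> inv\<^bsub>G\<^esub> y" by auto
    then have u: "u \<in> carrier G" "u \<otimes>\<^bsub>G\<^esub> (y \<otimes>\<^bsub>G\<^esub> x) = x \<otimes>\<^bsub>G\<^esub> y"
      by (auto simp: G.m_assoc G.inv_solve_left')
    obtain n b e where x: "x = mk n b e" "n \<in> carrier N" "b \<in> carrier B" using mk_cases[OF xy(1)] .
    obtain n' b' e' where y: "y = mk n' b' e'" "n' \<in> carrier N" "b' \<in> carrier B" using mk_cases[OF xy(2)] .
    obtain k c f where k: "u = mk k c f" "k \<in> carrier N" "c \<in> carrier B" using mk_cases[OF u(1)] .
    have "c \<otimes>\<^bsub>B\<^esub> (b' \<otimes>\<^bsub>B\<^esub> b) = b' \<otimes>\<^bsub>B\<^esub> b" "\<not> f"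
      using u(2) x y k by (auto simp: mk_mult mk_eq B.m_comm)
    then show "u \<in> ?N" using k x y by (auto simp: B.l_cancel_one)
  qed
  then have sub: "derived G (carrier G) \<subseteq> ?N"
    unfolding derived_def by (rule G.generate_subgroup_incl[OF _ N_subgroup])
  interpret D: group "G\<lparr>carrier := derived G (carrier G)\<rparr>"
    by (rule G.subgroup_imp_group[OF G.derived_is_subgroup]) simp
  have "x \<otimes>\<^bsub>G\<^esub> y = y \<otimes>\<^bsub>G\<^esub> x" if "x \<in> ?N" "y \<in> ?N" for x y
    using that by (auto simp: mk_mult N.m_comm twist_def)
  then have "comm_group (G\<lparr>carrier := derived G (carrier G)\<rparr>)"
    using sub by (intro D.group_comm_groupI) (simp, blast)
  then show ?thesis by (simp add: metabelian_def G.group_axioms)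
qed

section \<open>Hall systems and system normalizers\<close>

definition sylow_p :: "'g set" where
  "sylow_p = {mk n b False | n b. n \<in> carrier N \<and> b \<in> carrier B}"

text \<open>The conjugate of the standard involution by $h \<in> N$. Every element of $N$ is a square, so
  these are all involutions of $G$.\<close>

definition involution :: "'n \<Rightarrow> 'g" where
  "involution h = mk (h \<otimes>\<^bsub>N\<^esub> h) \<one>\<^bsub>B\<^esub> True"

definition hall_family :: "'n \<Rightarrow> nat set \<Rightarrow> 'g set" where
  "hall_family h \<pi> =
    (if 2 \<in> \<pi> then if p \<in> \<pi> then carrier G else {\<one>\<^bsub>G\<^esub>, involution h}
     else if p \<in> \<pi> then sylow_p else {\<one>\<^bsub>G\<^esub>})"

text \<open>The conjugate by $h$ of the complement $B \<times> C_2$ of $N$.\<close>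

definition involution_centralizer :: "'n \<Rightarrow> 'g set" where
  "involution_centralizer h =
    {mk (h \<otimes>\<^bsub>N\<^esub> twist N e (inv\<^bsub>N\<^esub> act b h)) b e | b e. b \<in> carrier B}"

lemma p_neq_2 [simp]: "p \<noteq> 2" using odd by auto

lemma primes_of_order: "prime_factors (order G) = {2, p}"
  using order_G prime r_pos two_is_prime_nat
  by (auto simp: prime_factors_product prime_factorization_prime_power set_mset_replicate_mset_subset
      prime_gt_0_nat prime_factorization_prime)

lemma mk_sylow_p: "\<lbrakk>n \<in> carrier N; b \<in> carrier B\<rbrakk> \<Longrightarrow> mk n b e \<in> sylow_p \<longleftrightarrow> \<not> e"
  by (auto simp: sylow_p_def mk_eq) blast

lemma sylow_p_normal: "sylow_p \<lhd> G"
proof (rule G.normal_invI)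
  show "subgroup sylow_p G"
  proof (rule G.subgroupI)
    fix x assume "x \<in> sylow_p"
    then obtain n b where n: "x = mk n b False" "n \<in> carrier N" "b \<in> carrier B" by (auto simp: sylow_p_def)
    obtain n' where "n' \<in> carrier N" "inv\<^bsub>G\<^esub> x = mk n' (inv\<^bsub>B\<^esub> b) False"
      using inv_mk[of n b False] n by auto
    then show "inv\<^bsub>G\<^esub> x \<in> sylow_p" using n by (auto simp: sylow_p_def)
  next
    fix x y assume "x \<in> sylow_p" "y \<in> sylow_p"
    then obtain n b n' b' where "x = mk n b False" "n \<in> carrier N" "b \<in> carrier B"
      "y = mk n' b' False" "n' \<in> carrier N" "b' \<in> carrier B" by (auto simp: sylow_p_def)
    then have "x \<otimes>\<^bsub>G\<^esub> y = mk (n \<otimes>\<^bsub>N\<^esub> act b n') (b \<otimes>\<^bsub>B\<^esub> b') False"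
      "n \<otimes>\<^bsub>N\<^esub> act b n' \<in> carrier N" "b \<otimes>\<^bsub>B\<^esub> b' \<in> carrier B" by (simp_all add: mk_mult twist_def)
    then show "x \<otimes>\<^bsub>G\<^esub> y \<in> sylow_p" unfolding sylow_p_def by blast
  qed (auto simp: sylow_p_def)
next
  fix x y assume "x \<in> carrier G" "y \<in> sylow_p"
  then obtain n b e n' b' where x: "x = mk n b e" "n \<in> carrier N" "b \<in> carrier B"
    and y: "y = mk n' b' False" "n' \<in> carrier N" "b' \<in> carrier B"
    by (auto simp: sylow_p_def elim: mk_cases)
  obtain n'' where "n'' \<in> carrier N" "inv\<^bsub>G\<^esub> x = mk n'' (inv\<^bsub>B\<^esub> b) e"
    using inv_mk[of n b e] x by auto
  then show "x \<otimes>\<^bsub>G\<^esub> y \<otimes>\<^bsub>G\<^esub> inv\<^bsub>G\<^esub> x \<in> sylow_p" using x y by (simp add: mk_mult mk_sylow_p)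
qed

lemma card_sylow_p: "card sylow_p = p ^ (r + s)"
proof -
  have "sylow_p = {mk n b e | n b e. n \<in> carrier N \<and> b \<in> carrier B \<and> e \<in> {False}}"
    by (auto simp: sylow_p_def) blast
  then show ?thesis
    using card_mk[of "carrier N" "carrier B" "{False}"] order_N order_B
    by (simp add: order_def power_add)
qed

lemma involution_props:
  assumes "h \<in> carrier N"
  shows "involution h \<in> carrier G" "involution h \<noteq> \<one>\<^bsub>G\<^esub>" "involution h \<otimes>\<^bsub>G\<^esub> involution h = \<one>\<^bsub>G\<^esub>"
  using assms by (auto simp: involution_def one_G mk_eq mk_mult twist_def)

lemma involution_subgroup:
  assumes "h \<in> carrier N"
  shows "subgroup {\<one>\<^bsub>G\<^esub>, involution h} G"
  using involution_props[OF assms] G.inv_equality by (intro G.subgroupI) auto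

lemma hall_subgroup_iff:
  assumes "\<pi> \<subseteq> {2, p}"
  shows "hall_subgroup G \<pi> K \<longleftrightarrow> subgroup K G \<and>
    card K = (if 2 \<in> \<pi> then 2 else 1) * (if p \<in> \<pi> then p ^ (r + s) else 1)"
proof (cases "subgroup K G")
  case True
  have "card K * card (rcosets\<^bsub>G\<^esub> K) = 2 * p ^ (r + s)"
    using G.lagrange[OF True] by (simp add: order_G mult.commute)
  from split_prime_powers[OF prime odd _ this assms] True r_pos show ?thesis
    by (simp add: hall_subgroup_def)
qed (simp add: hall_subgroup_def)

lemma hall_family_hall:
  assumes "h \<in> carrier N" "\<pi> \<subseteq> {2, p}"
  shows "hall_subgroup G \<pi> (hall_family h \<pi>)"
  using assms involution_subgroup involution_props(2)[OF assms(1)] G.triv_subgroup G.subgroup_self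
    sylow_p_normal[THEN normal_imp_subgroup] order_G
  by (auto simp: hall_subgroup_iff hall_family_def card_sylow_p order_def card_2_iff)

lemma even_power_unflipped:
  assumes "n \<in> carrier N" "b \<in> carrier B"
  shows "\<exists>n' \<in> carrier N. \<exists>b' \<in> carrier B. mk n b e [^]\<^bsub>G\<^esub> (k::nat) = mk n' b' (e \<and> odd k)"
proof (induction k)
  case 0
  then show ?case by (auto simp: one_G)
next
  case (Suc k)
  then obtain n' b' where k: "n' \<in> carrier N" "b' \<in> carrier B"
    "mk n b e [^]\<^bsub>G\<^esub> k = mk n' b' (e \<and> odd k)" by blast
  have flag: "((e \<and> odd k) \<noteq> e) = (e \<and> odd (Suc k))" by auto
  have "mk n b e [^]\<^bsub>G\<^esub> Suc k = mk (n' \<otimes>\<^bsub>N\<^esub> twist N (e \<and> odd k) (act b' n)) (b' \<otimes>\<^bsub>B\<^esub> b)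
    (e \<and> odd (Suc k))"
    unfolding flag[symmetric] using k assms by (simp add: mk_mult)
  then show ?case using k assms by (meson N.m_closed B.m_closed twist_closed act_closed)
qed

text \<open>Elements outside the normal Sylow $p$-subgroup have no odd power equal to $1$.\<close>

lemma sylow_p_unique:
  assumes K: "subgroup K G" "card K = p ^ (r + s)"
  shows "K = sylow_p"
proof (rule card_subset_eq)
  show "finite sylow_p" using sylow_p_normal finite_G
    by (meson finite_subset normal_imp_subgroup subgroup.subset)
  show "card K = card sylow_p" by (simp add: K(2) card_sylow_p)
  show "K \<subseteq> sylow_p"
  proof
    fix x assume x: "x \<in> K"
    then have "x \<in> carrier G" using K(1) subgroup.mem_carrier by fast
    then obtain n b e where nbe: "x = mk n b e" "n \<in> carrier N" "b \<in> carrier B" by (rule mk_cases)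
    interpret K: group "G\<lparr>carrier := K\<rparr>" by (rule G.subgroup_imp_group[OF K(1)])
    have "x [^]\<^bsub>G\<^esub> card K = \<one>\<^bsub>G\<^esub>"
      using K.pow_order_eq_1[of x] x by (simp add: order_def flip: G.nat_pow_consistent)
    moreover have "odd (card K)" using odd by (simp add: K(2))
    ultimately have "\<not> e" using even_power_unflipped[OF nbe(2,3), of e "card K"] nbe
      by (auto simp: one_G mk_eq)
    then show "x \<in> sylow_p" using nbe by (auto simp: sylow_p_def)
  qed
qed

lemma hall_2_involution:
  assumes K: "subgroup K G" "card K = 2"
  obtains h where "h \<in> carrier N" "K = {\<one>\<^bsub>G\<^esub>, involution h}"
proof -
  have "\<one>\<^bsub>G\<^esub> \<in> K" using K(1) by (rule subgroup.one_closed)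
  then obtain x where x: "K = {\<one>\<^bsub>G\<^esub>, x}" "x \<noteq> \<one>\<^bsub>G\<^esub>" using K(2) by (auto simp: card_2_iff doubleton_eq_iff)
  then have xG: "x \<in> carrier G" using K(1) subgroup.mem_carrier by fast
  have "x \<otimes>\<^bsub>G\<^esub> x \<in> K" using subgroup.m_closed[OF K(1), of x x] x(1) by simp
  then have xx: "x \<otimes>\<^bsub>G\<^esub> x = \<one>\<^bsub>G\<^esub>" using x xG by auto
  obtain n b e where nbe: "x = mk n b e" "n \<in> carrier N" "b \<in> carrier B" using mk_cases[OF xG] .
  have "b \<otimes>\<^bsub>B\<^esub> b = \<one>\<^bsub>B\<^esub> \<otimes>\<^bsub>B\<^esub> \<one>\<^bsub>B\<^esub>" using xx nbe by (auto simp: mk_mult one_G mk_eq)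
  then have b: "b = \<one>\<^bsub>B\<^esub>" using B.square_inj[OF odd_B] nbe by blast
  have e
  proof (rule ccontr)
    assume "\<not> e"
    then have "n \<otimes>\<^bsub>N\<^esub> n = \<one>\<^bsub>N\<^esub> \<otimes>\<^bsub>N\<^esub> \<one>\<^bsub>N\<^esub>" using xx nbe b by (auto simp: mk_mult one_G mk_eq twist_def)
    then have "n = \<one>\<^bsub>N\<^esub>" using N.square_inj[OF odd_N] nbe by blast
    then show False using x(2) nbe b \<open>\<not> e\<close> by (simp add: one_G)
  qed
  obtain h where "h \<in> carrier N" "h \<otimes>\<^bsub>N\<^esub> h = n" using N.square_root[OF odd_N nbe(2)] .
  then show thesis using that x(1) nbe b \<open>e\<close> by (auto simp: involution_def)
qed

text \<open>All Hall subgroups except those of order two are normal, hence unique. A Hall system is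
  therefore determined by an involution.\<close>

lemma hall_family_unique:
  assumes H: "\<And>\<pi>. \<pi> \<subseteq> {2, p} \<Longrightarrow> hall_subgroup G \<pi> (\<H> \<pi>)"
  shows "\<exists>h \<in> carrier N. \<forall>\<pi> \<subseteq> {2, p}. \<H> \<pi> = hall_family h \<pi>"
proof -
  have "subgroup (\<H> {2}) G \<and> card (\<H> {2}) = 2"
    using H[of "{2}"] p_neq_2 by (simp add: hall_subgroup_iff)
  then obtain h where h: "h \<in> carrier N" "\<H> {2} = {\<one>\<^bsub>G\<^esub>, involution h}"
    using hall_2_involution by blast
  have "\<H> \<pi> = hall_family h \<pi>" if \<pi>: "\<pi> \<subseteq> {2, p}" for \<pi>
  proof -
    have K: "subgroup (\<H> \<pi>) G"
      "card (\<H> \<pi>) = (if 2 \<in> \<pi> then 2 else 1) * (if p \<in> \<pi> then p ^ (r + s) else 1)"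
      using H[OF \<pi>] by (auto simp: hall_subgroup_iff \<pi>)
    consider "\<pi> = {}" | "\<pi> = {2}" | "\<pi> = {p}" | "\<pi> = {2, p}" using \<pi> by blast
    then show ?thesis
    proof cases
      case 1
      then have "card (\<H> \<pi>) = 1" using K by simp
      moreover have "\<one>\<^bsub>G\<^esub> \<in> \<H> \<pi>" using K(1) by (rule subgroup.one_closed)
      ultimately show ?thesis using 1 by (auto simp: hall_family_def card_1_singleton_iff)
    next
      case 2
      then show ?thesis using h p_neq_2 by (simp add: hall_family_def)
    next
      case 3
      then show ?thesis using sylow_p_unique[OF K(1)] K(2) p_neq_2 by (simp add: hall_family_def)
    next
      case 4
      then have "\<H> \<pi> = carrier G"
        using K order_G by (intro card_subset_eq) (auto simp: order_def subgroup.subset)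
      then show ?thesis using 4 by (simp add: hall_family_def)
    qed
  qed
  with h(1) show ?thesis by blast
qed

lemma hall_family_system:
  assumes "h \<in> carrier N"
  shows "hall_system G (hall_family h)"
  unfolding hall_system_def primes_of_order
proof (intro conjI allI impI)
  fix \<pi> \<rho> :: "nat set" assume \<pi>: "\<pi> \<subseteq> {2, p}" and \<rho>: "\<rho> \<subseteq> {2, p}"
  have sub: "subgroup (hall_family h \<sigma>) G" if "\<sigma> \<subseteq> {2, p}" for \<sigma>
    using hall_family_hall[OF assms that] by (simp add: hall_subgroup_def)
  have norm: "hall_family h \<sigma> \<lhd> G" if "\<sigma> \<subseteq> {2, p}" "hall_family h \<sigma> \<noteq> {\<one>\<^bsub>G\<^esub>, involution h}" for \<sigma>
    using that sylow_p_normal G.one_is_normal G.normal_self by (auto simp: hall_family_def)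
  show "hall_family h \<pi> <#>\<^bsub>G\<^esub> hall_family h \<rho> = hall_family h \<rho> <#>\<^bsub>G\<^esub> hall_family h \<pi>"
    using norm[OF \<pi>] norm[OF \<rho>] G.commut_normal[OF sub[OF \<pi>]] G.commut_normal[OF sub[OF \<rho>]] by metis
qed (use hall_family_hall assms in auto)

lemma mem_involution_centralizer:
  assumes "h \<in> carrier N" "n \<in> carrier N" "b \<in> carrier B"
  shows "mk n b e \<in> involution_centralizer h \<longleftrightarrow> n = h \<otimes>\<^bsub>N\<^esub> twist N e (inv\<^bsub>N\<^esub> act b h)"
proof -
  have "mk n b e \<in> involution_centralizer h \<longleftrightarrow> (\<exists>b' e'. b' \<in> carrier B \<and>
      mk n b e = mk (h \<otimes>\<^bsub>N\<^esub> twist N e' (inv\<^bsub>N\<^esub> act b' h)) b' e')"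
    by (auto simp: involution_centralizer_def)
  also have "\<dots> \<longleftrightarrow> n = h \<otimes>\<^bsub>N\<^esub> twist N e (inv\<^bsub>N\<^esub> act b h)"
    using assms by (auto simp: mk_eq)
  finally show ?thesis .
qed

lemma involution_centralizer_in: "h \<in> carrier N \<Longrightarrow> involution_centralizer h \<subseteq> carrier G"
  by (auto simp: involution_centralizer_def)

text \<open>Commuting with the involution $h^2 t$ amounts to an equation between squares in $N$;
  taking square roots solves it for the first coordinate.\<close>

lemma normalizer_involution_eq:
  assumes h: "h \<in> carrier N"
  shows "normalizer G {\<one>\<^bsub>G\<^esub>, involution h} = involution_centralizer h"
proof -
  have "x \<otimes>\<^bsub>G\<^esub> involution h = involution h \<otimes>\<^bsub>G\<^esub> x \<longleftrightarrow> x \<in> involution_centralizer h"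
    if xG: "x \<in> carrier G" for x
  proof -
    obtain n b e where x: "x = mk n b e" "n \<in> carrier N" "b \<in> carrier B" using mk_cases[OF xG] .
    define w where "w = twist N e (act b h)"
    have w: "w \<in> carrier N" "inv\<^bsub>N\<^esub> w = twist N e (inv\<^bsub>N\<^esub> act b h)"
      using h x by (auto simp: w_def twist_def)
    have ww: "twist N e (act b (h \<otimes>\<^bsub>N\<^esub> h)) = w \<otimes>\<^bsub>N\<^esub> w"
      using h x by (simp add: w_def twist_def act_mult N.inv_mult)
    have "x \<otimes>\<^bsub>G\<^esub> involution h = involution h \<otimes>\<^bsub>G\<^esub> x \<longleftrightarrow>
        n \<otimes>\<^bsub>N\<^esub> (w \<otimes>\<^bsub>N\<^esub> w) = h \<otimes>\<^bsub>N\<^esub> h \<otimes>\<^bsub>N\<^esub> inv\<^bsub>N\<^esub> n"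
      using x h w ww by (auto simp: involution_def mk_mult mk_eq twist_def[of N True])
    also have "\<dots> \<longleftrightarrow> n \<otimes>\<^bsub>N\<^esub> (w \<otimes>\<^bsub>N\<^esub> w) \<otimes>\<^bsub>N\<^esub> n = h \<otimes>\<^bsub>N\<^esub> h"
      using x h w by (metis N.inv_solve_right N.m_closed)
    also have "n \<otimes>\<^bsub>N\<^esub> (w \<otimes>\<^bsub>N\<^esub> w) \<otimes>\<^bsub>N\<^esub> n = (n \<otimes>\<^bsub>N\<^esub> w) \<otimes>\<^bsub>N\<^esub> (n \<otimes>\<^bsub>N\<^esub> w)"
      using x w by (simp add: N.m_ac)
    also have "\<dots> = h \<otimes>\<^bsub>N\<^esub> h \<longleftrightarrow> n \<otimes>\<^bsub>N\<^esub> w = h"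
      using N.square_inj[OF odd_N, of "n \<otimes>\<^bsub>N\<^esub> w" h] x w h by auto
    also have "\<dots> \<longleftrightarrow> n = h \<otimes>\<^bsub>N\<^esub> inv\<^bsub>N\<^esub> w"
      using x w h by (metis N.inv_solve_right)
    also have "\<dots> \<longleftrightarrow> x \<in> involution_centralizer h"
      using mem_involution_centralizer[OF h x(2,3)] w x(1) by simp
    finally show ?thesis .
  qed
  then show ?thesis
    using G.normalizer_involution[OF involution_props(1,2)[OF h]] involution_centralizer_in[OF h] by blast
qed

lemma hall_family_normalizer:
  assumes "h \<in> carrier N"
  shows "(\<Inter>\<pi>\<in>Pow {2, p}. normalizer G (hall_family h \<pi>)) = involution_centralizer h"
proof -
  have "normalizer G (hall_family h \<pi>) = (if \<pi> = {2} then involution_centralizer h else carrier G)"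
    if \<pi>: "\<pi> \<subseteq> {2, p}" for \<pi>
  proof -
    consider "\<pi> = {}" | "\<pi> = {2}" | "\<pi> = {p}" | "\<pi> = {2, p}" using \<pi> by blast
    then show ?thesis
      using normalizer_involution_eq[OF assms] G.normal_normalizer[OF sylow_p_normal]
        G.normal_normalizer[OF G.one_is_normal] G.normal_normalizer[OF G.normal_self]
      by cases (simp_all add: hall_family_def doubleton_eq_iff p_neq_2[symmetric])
  qed
  then show ?thesis using involution_centralizer_in[OF assms] by auto
qed

lemma system_normalizers_eq: "system_normalizers G = involution_centralizer ` carrier N"
proof (intro equalityI subsetI)
  fix D assume "D \<in> system_normalizers G"
  then obtain \<H> where D: "D = hall_system_normalizer G \<H>" and \<H>: "hall_system G \<H>"
    by (auto simp: system_normalizers_def)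
  have "\<And>\<pi>. \<pi> \<subseteq> {2, p} \<Longrightarrow> hall_subgroup G \<pi> (\<H> \<pi>)"
    using \<H> by (simp add: hall_system_def primes_of_order)
  then obtain h where h: "h \<in> carrier N" "\<And>\<pi>. \<pi> \<subseteq> {2, p} \<Longrightarrow> \<H> \<pi> = hall_family h \<pi>"
    using hall_family_unique by metis
  have "D = (\<Inter>\<pi>\<in>Pow {2, p}. normalizer G (hall_family h \<pi>))"
    unfolding D hall_system_normalizer_def primes_of_order using h(2) by auto
  then show "D \<in> involution_centralizer ` carrier N" using hall_family_normalizer h(1) by blast
next
  fix D assume "D \<in> involution_centralizer ` carrier N"
  then obtain h where h: "h \<in> carrier N" "D = involution_centralizer h" by blast
  then have "D = hall_system_normalizer G (hall_family h)"
    by (simp add: hall_system_normalizer_def primes_of_order hall_family_normalizer del: Pow_insert)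
  then show "D \<in> system_normalizers G" using hall_family_system[OF h(1)] by (auto simp: system_normalizers_def)
qed

lemma involution_in_centralizer: "h \<in> carrier N \<Longrightarrow> involution h \<in> involution_centralizer h"
  by (simp add: involution_def mem_involution_centralizer twist_def)

lemma involution_not_central: "h \<in> carrier N \<Longrightarrow> involution h \<notin> central"
  by (auto simp: involution_def central_def act_kernel_def mk_eq)

text \<open>One system normalizer is too large because it contains an involution. If $B$ acts
  trivially, then every system normalizer contains $B$, which is the hypercenter, and two different ones have no
  involution in common.\<close>

lemma least_number_trivial_action:
  assumes triv: "\<And>b n. \<lbrakk>b \<in> carrier B; n \<in> carrier N\<rbrakk> \<Longrightarrow> act b n = n"
  shows "least_system_normalizer_number G 2"
proof -
  have lower: "2 \<le> card \<D>" if \<D>: "hypercenter_family G \<D>" for \<D>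
  proof (rule ccontr)
    assume "\<not> 2 \<le> card \<D>"
    moreover have "finite \<D>" "\<D> \<noteq> {}" using \<D> by (auto simp: hypercenter_family_def)
    ultimately have "card \<D> = 1" by (cases "card \<D>") auto
    then obtain D where "\<D> = {D}" by (auto simp: card_1_singleton_iff)
    then have "D \<in> system_normalizers G" "D = central"
      using \<D> by (auto simp: hypercenter_family_def hypercenter_eq)
    then show False
      using involution_in_centralizer involution_not_central by (auto simp: system_normalizers_eq)
  qed
  have "order N \<noteq> 1" using order_N r_pos prime_gt_1_nat[OF prime] by simp
  then have "carrier N \<noteq> {\<one>\<^bsub>N\<^esub>}" by (auto simp: order_def)
  then obtain h where h: "h \<in> carrier N" "h \<noteq> \<one>\<^bsub>N\<^esub>" by blast
  let ?D = "{involution_centralizer \<one>\<^bsub>N\<^esub>, involution_centralizer h}"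
  have "\<Inter>?D = central"
  proof (intro equalityI subsetI)
    fix x assume x: "x \<in> \<Inter>?D"
    then have "x \<in> carrier G" using involution_centralizer_in[OF h(1)] by blast
    then obtain n b e where nbe: "x = mk n b e" "n \<in> carrier N" "b \<in> carrier B" by (rule mk_cases)
    have 1: "n = \<one>\<^bsub>N\<^esub>" and 2: "n = h \<otimes>\<^bsub>N\<^esub> twist N e (inv\<^bsub>N\<^esub> act b h)"
      using x nbe h by (auto simp: mem_involution_centralizer)
    have "\<not> e"
    proof
      assume e
      then have "h \<otimes>\<^bsub>N\<^esub> h = \<one>\<^bsub>N\<^esub> \<otimes>\<^bsub>N\<^esub> \<one>\<^bsub>N\<^esub>" using 1 2 nbe h by (simp add: triv twist_def)
      then show False using N.square_inj[OF odd_N] h by blast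
    qed
    then show "x \<in> central" using 1 nbe triv by (auto simp: central_def act_kernel_def)
  next
    fix x assume "x \<in> central"
    then obtain b where "x = mk \<one>\<^bsub>N\<^esub> b False" "b \<in> carrier B" by (auto simp: central_def act_kernel_def)
    then show "x \<in> \<Inter>?D" using h triv by (auto simp: mem_involution_centralizer twist_def)
  qed
  then have fam: "hypercenter_family G ?D"
    using h by (auto simp: hypercenter_family_def system_normalizers_eq hypercenter_eq)
  moreover have "card ?D \<le> 2" by (simp add: card_insert_if)
  ultimately show ?thesis using lower[OF fam] lower unfolding least_system_normalizer_number_def
    by (metis le_antisym)
qed

end

section \<open>Maximal subgroups\<close>

context inverted_extension begin

lemma lift_subgroup:
  assumes K: "subgroup K N" and L: "subgroup L B"
    and inv: "\<And>b n. \<lbrakk>b \<in> carrier B; n \<in> K\<rbrakk> \<Longrightarrow> act b n \<in> K"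
  shows "subgroup {mk n b e | n b e. n \<in> K \<and> b \<in> L} G" (is "subgroup ?M G")
proof (rule G.finite_closed_subgroup)
  show "?M \<subseteq> carrier G" using K L by (auto simp: subgroup.mem_carrier)
  show "\<one>\<^bsub>G\<^esub> \<in> ?M" using subgroup.one_closed[OF K] subgroup.one_closed[OF L] by (auto simp: one_G)
  fix x y assume "x \<in> ?M" "y \<in> ?M"
  then obtain n b e n' b' e' where x: "x = mk n b e" "n \<in> K" "b \<in> L"
    and y: "y = mk n' b' e'" "n' \<in> K" "b' \<in> L" by blast
  have "twist N e (act b n') \<in> K"
    using inv[of b n'] x y K L by (simp add: twist_def subgroup.m_inv_closed subgroup.mem_carrier)
  then have "n \<otimes>\<^bsub>N\<^esub> twist N e (act b n') \<in> K" "b \<otimes>\<^bsub>B\<^esub> b' \<in> L"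
    using x y K L by (simp_all add: subgroup.m_closed)
  moreover have "x \<otimes>\<^bsub>G\<^esub> y = mk (n \<otimes>\<^bsub>N\<^esub> twist N e (act b n')) (b \<otimes>\<^bsub>B\<^esub> b') (e \<noteq> e')"
    using x y K L by (simp add: mk_mult subgroup.mem_carrier)
  ultimately show "x \<otimes>\<^bsub>G\<^esub> y \<in> ?M" by blast
qed simp

text \<open>A proper subgroup of prime index is maximal, so subgroups of index $p$ in the two factors give
  maximal subgroups of $G$.\<close>

lemma lift_maximal:
  assumes K: "subgroup K N" and L: "subgroup L B"
    and inv: "\<And>b n. \<lbrakk>b \<in> carrier B; n \<in> K\<rbrakk> \<Longrightarrow> act b n \<in> K"
    and card: "card K * card L * p = order N * order B"
  shows "maximal_subgroup {mk n b e | n b e. n \<in> K \<and> b \<in> L} G"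
proof (rule G.prime_index_maximal[OF finite_G lift_subgroup[OF assms(1-3)] prime])
  have "card {mk n b e | n b e. n \<in> K \<and> b \<in> L} = 2 * (card K * card L)"
    using card_mk[of K L UNIV] K L by (simp add: subgroup.subset card_UNIV_bool)
  then show "card {mk n b e | n b e. n \<in> K \<and> b \<in> L} * p = order G"
    using card by (simp add: order_G order_N order_B power_add mult.assoc)
qed

lemma sylow_p_maximal: "maximal_subgroup sylow_p G"
  using sylow_p_normal
  by (intro G.prime_index_maximal[OF _ _ two_is_prime_nat])
     (auto simp: card_sylow_p order_G normal_imp_subgroup)

end

section \<open>Extensions from a pairing\<close>

text \<open>Here $N = A \<times> Z$, and $b$ sends $(a, z)$ to $(a, z\,\omega(a,b))$: the group $NB$ is
  of Heisenberg type with commutator pairing $\omega : A \<times> B \<rightarrow> Z$. The elements $\alpha_0, \ldots,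
  \alpha_{m-1}$ have trivial common annihilator in $B$; since $|B| = |Z|^m$, no smaller family has this property.
  The subgroups of index $p$ that separate points, together with surjectivity of $\omega$, force the Frattini subgroup
  to be $Z$.\<close>

locale twisted_heisenberg =
  inverted_extension "A \<times>\<times> Z" B "\<lambda>b (a, z). (a, z \<otimes>\<^bsub>Z\<^esub> \<omega> a b)" p r s G mk +
  A: comm_group A + Z: comm_group Z
  for A :: "'a monoid" and Z :: "'z monoid" and B :: "'b monoid"
    and \<omega> :: "'a \<Rightarrow> 'b \<Rightarrow> 'z" and p r s :: nat and G :: "'g monoid" and mk +
  fixes rA q m :: nat and \<alpha> :: "nat \<Rightarrow> 'a"
  assumes order_A: "order A = p ^ rA" and rA_pos: "rA > 0"
    and order_Z: "order Z = q" and order_B_q: "order B = q ^ m" and m_pos: "m \<ge> 1"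
    and q_gt_1: "q > 1"
    and \<omega>_closed [simp]: "\<lbrakk>a \<in> carrier A; b \<in> carrier B\<rbrakk> \<Longrightarrow> \<omega> a b \<in> carrier Z"
    and \<omega>_surj: "z \<in> carrier Z \<Longrightarrow> \<exists>a \<in> carrier A. \<exists>b \<in> carrier B. \<omega> a b = z"
    and \<alpha>_in: "i < m \<Longrightarrow> \<alpha> i \<in> carrier A"
    and \<alpha>_detects: "\<lbrakk>b \<in> carrier B; \<And>i. i < m \<Longrightarrow> \<omega> (\<alpha> i) b = \<one>\<^bsub>Z\<^esub>\<rbrakk> \<Longrightarrow> b = \<one>\<^bsub>B\<^esub>"
    and hyperplane_A: "\<lbrakk>a \<in> carrier A; a \<noteq> \<one>\<^bsub>A\<^esub>\<rbrakk>
      \<Longrightarrow> \<exists>K. subgroup K A \<and> a \<notin> K \<and> card K * p = order A"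
    and hyperplane_B: "\<lbrakk>b \<in> carrier B; b \<noteq> \<one>\<^bsub>B\<^esub>\<rbrakk>
      \<Longrightarrow> \<exists>K. subgroup K B \<and> b \<notin> K \<and> card K * p = order B"
begin

lemma inv_AZ [simp]: "\<lbrakk>a \<in> carrier A; z \<in> carrier Z\<rbrakk> \<Longrightarrow>
    inv\<^bsub>A \<times>\<times> Z\<^esub> (a, z) = (inv\<^bsub>A\<^esub> a, inv\<^bsub>Z\<^esub> z)"
  by (simp add: A.group_axioms Z.group_axioms)

lemma twist_AZ [simp]: "\<lbrakk>a \<in> carrier A; z \<in> carrier Z\<rbrakk> \<Longrightarrow>
    twist (A \<times>\<times> Z) e (a, z) = (twist A e a, twist Z e z)"
  by (simp add: twist_def)

lemma twist_AZ_closed [simp]: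
  "a \<in> carrier A \<Longrightarrow> twist A e a \<in> carrier A" "z \<in> carrier Z \<Longrightarrow> twist Z e z \<in> carrier Z"
  by (simp_all add: twist_def)

lemma finite_AZ [simp]: "finite (carrier A)" "finite (carrier Z)"
  using order_A order_Z q_gt_1 prime_gt_0_nat[OF prime]
  by (metis order_def card.infinite less_irrefl zero_less_power, metis order_def card.infinite not_less_zero)


lemma \<omega>_mult_right:
  assumes "a \<in> carrier A" "b \<in> carrier B" "b' \<in> carrier B"
  shows "\<omega> a (b \<otimes>\<^bsub>B\<^esub> b') = \<omega> a b \<otimes>\<^bsub>Z\<^esub> \<omega> a b'"
  using act_act[of b b' "(a, \<one>\<^bsub>Z\<^esub>)"] assms by (simp add: Z.m_comm)

lemma \<omega>_one_right [simp]: "a \<in> carrier A \<Longrightarrow> \<omega> a \<one>\<^bsub>B\<^esub> = \<one>\<^bsub>Z\<^esub>"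
  using act_id[of "(a, \<one>\<^bsub>Z\<^esub>)"] by simp

lemma \<omega>_one_left [simp]: "b \<in> carrier B \<Longrightarrow> \<omega> \<one>\<^bsub>A\<^esub> b = \<one>\<^bsub>Z\<^esub>"
  using act_one[of b] by simp

lemma \<omega>_inv_right:
  assumes "a \<in> carrier A" "b \<in> carrier B"
  shows "\<omega> a (inv\<^bsub>B\<^esub> b) = inv\<^bsub>Z\<^esub> \<omega> a b"
  using \<omega>_mult_right[of a "inv\<^bsub>B\<^esub> b" b] assms by (simp add: Z.inv_equality)

lemma act_kernel_trivial: "act_kernel = {\<one>\<^bsub>B\<^esub>}"
proof -
  have "b = \<one>\<^bsub>B\<^esub>" if b: "b \<in> act_kernel" for b
  proof (rule \<alpha>_detects)
    show bB: "b \<in> carrier B" using b by (simp add: act_kernel_def)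
    fix i assume "i < m"
    then have "(\<alpha> i, \<one>\<^bsub>Z\<^esub>) \<in> carrier (A \<times>\<times> Z)" using \<alpha>_in by simp
    then have "(case (\<alpha> i, \<one>\<^bsub>Z\<^esub>) of (a, z) \<Rightarrow> (a, z \<otimes>\<^bsub>Z\<^esub> \<omega> a b)) = (\<alpha> i, \<one>\<^bsub>Z\<^esub>)"
      using b unfolding act_kernel_def by blast
    then show "\<omega> (\<alpha> i) b = \<one>\<^bsub>Z\<^esub>" using bB \<alpha>_in \<open>i < m\<close> by simp
  qed
  then show ?thesis by (auto simp: act_kernel_def)
qed

lemma hypercenter_trivial: "hypercenter G = {\<one>\<^bsub>G\<^esub>}"
  by (simp add: hypercenter_eq central_def act_kernel_trivial one_G)

section \<open>The Frattini subgroup and its quotient\<close>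

text \<open>The embedding of $Z$ into $G$; the image is central in $NB$ and inverted by the involution.\<close>

definition \<zeta> :: "'z \<Rightarrow> 'g" where "\<zeta> z = mk (\<one>\<^bsub>A\<^esub>, z) \<one>\<^bsub>B\<^esub> False"

lemma \<zeta>_in [simp]: "z \<in> carrier Z \<Longrightarrow> \<zeta> z \<in> carrier G"
  by (simp add: \<zeta>_def)

lemma \<zeta>_mult: "\<lbrakk>a \<in> carrier A; z \<in> carrier Z; b \<in> carrier B; w \<in> carrier Z\<rbrakk> \<Longrightarrow>
    \<zeta> w \<otimes>\<^bsub>G\<^esub> mk (a, z) b e = mk (a, w \<otimes>\<^bsub>Z\<^esub> z) b e"
  by (simp add: \<zeta>_def mk_mult twist_def)

lemma \<zeta>_image_normal: "\<zeta> ` carrier Z \<lhd> G"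
proof (rule G.normal_invI)
  show "subgroup (\<zeta> ` carrier Z) G"
  proof (rule G.finite_closed_subgroup)
    show "\<one>\<^bsub>G\<^esub> \<in> \<zeta> ` carrier Z" by (auto simp: \<zeta>_def one_G)
  next
    fix x y assume "x \<in> \<zeta> ` carrier Z" "y \<in> \<zeta> ` carrier Z"
    then show "x \<otimes>\<^bsub>G\<^esub> y \<in> \<zeta> ` carrier Z" by (auto simp: \<zeta>_mult) (auto simp: \<zeta>_def mk_mult twist_def)
  qed auto
next
  fix x h assume x: "x \<in> carrier G" and "h \<in> \<zeta> ` carrier Z"
  then obtain z where z: "h = \<zeta> z" "z \<in> carrier Z" by blast
  obtain n b e where "x = mk n b e" "n \<in> carrier (A \<times>\<times> Z)" "b \<in> carrier B" using mk_cases[OF x] .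
  then obtain a w where "x = mk (a, w) b e" "a \<in> carrier A" "w \<in> carrier Z" "b \<in> carrier B" by auto
  then have "x \<otimes>\<^bsub>G\<^esub> h = \<zeta> (twist Z e z) \<otimes>\<^bsub>G\<^esub> x"
    using z by (simp add: \<zeta>_mult) (simp add: \<zeta>_def mk_mult Z.m_comm twist_def)
  then have "x \<otimes>\<^bsub>G\<^esub> h \<otimes>\<^bsub>G\<^esub> inv\<^bsub>G\<^esub> x = \<zeta> (twist Z e z)" using x z by (simp add: G.m_assoc)
  then show "x \<otimes>\<^bsub>G\<^esub> h \<otimes>\<^bsub>G\<^esub> inv\<^bsub>G\<^esub> x \<in> \<zeta> ` carrier Z" using z by simp
qed

text \<open>If a maximal subgroup $M$ did not contain $Z$, then $MZ = G$, and any pair $a \<in> A$,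
  $b \<in> B$ could be changed by elements of $Z$ to lie in $M$. As $Z$ commutes with $A$ and $B$, this does not affect
  their commutator $\omega(a,b)$, which therefore lies in $M$. But every element of $Z$ is of this form.\<close>

lemma \<zeta>_in_maximal:
  assumes M: "maximal_subgroup M G" and z: "z \<in> carrier Z"
  shows "\<zeta> z \<in> M"
proof -
  let ?Z = "\<zeta> ` carrier Z"
  have MG: "subgroup M G" using M by (simp add: maximal_subgroup_def)
  have Zsub: "subgroup ?Z G" using \<zeta>_image_normal by (rule normal_imp_subgroup)
  have sub: "subgroup (?Z <#>\<^bsub>G\<^esub> M) G" by (rule G.mult_norm_subgroup[OF \<zeta>_image_normal MG])
  have "M \<subseteq> ?Z <#>\<^bsub>G\<^esub> M"
    using subgroup.one_closed[OF Zsub] subgroup.mem_carrier[OF MG] by (force simp: set_mult_def)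
  then consider "?Z <#>\<^bsub>G\<^esub> M = M" | "?Z <#>\<^bsub>G\<^esub> M = carrier G" using M sub by (auto simp: maximal_subgroup_def)
  then show ?thesis
  proof cases
    case 1
    have "\<zeta> z \<otimes>\<^bsub>G\<^esub> \<one>\<^bsub>G\<^esub> \<in> ?Z <#>\<^bsub>G\<^esub> M"
      using z subgroup.one_closed[OF MG] unfolding set_mult_def by blast
    then show ?thesis using 1 z by simp
  next
    case 2
    have lift: "\<exists>w \<in> carrier Z. mk (a, w) b False \<in> M" if ab: "a \<in> carrier A" "b \<in> carrier B" for a b
    proof -
      have "mk (a, \<one>\<^bsub>Z\<^esub>) b False \<in> ?Z <#>\<^bsub>G\<^esub> M" using ab by (simp add: 2)
      then obtain v x where v: "v \<in> carrier Z" "x \<in> M" "mk (a, \<one>\<^bsub>Z\<^esub>) b False = \<zeta> v \<otimes>\<^bsub>G\<^esub> x"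
        by (auto simp: set_mult_def)
      then have "x \<in> carrier G" using MG subgroup.mem_carrier by fast
      then obtain n c e where "x = mk n c e" "n \<in> carrier (A \<times>\<times> Z)" "c \<in> carrier B" by (rule mk_cases)
      then obtain a' w where x: "x = mk (a', w) c e" "a' \<in> carrier A" "w \<in> carrier Z" "c \<in> carrier B" by auto
      have "a' = a" "c = b" "\<not> e" using v(3) x v(1) ab by (auto simp: \<zeta>_mult mk_eq)
      then show ?thesis using x v(2) by auto
    qed
    obtain a b where ab: "a \<in> carrier A" "b \<in> carrier B" "\<omega> a b = z" using \<omega>_surj[OF z] by blast
    obtain u where u: "u \<in> carrier Z" "mk (a, u) \<one>\<^bsub>B\<^esub> False \<in> M" using lift[of a "\<one>\<^bsub>B\<^esub>"] ab by auto
    obtain v where v: "v \<in> carrier Z" "mk (\<one>\<^bsub>A\<^esub>, v) b False \<in> M" using lift[of "\<one>\<^bsub>A\<^esub>" b] ab by auto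
    let ?x = "mk (a, u) \<one>\<^bsub>B\<^esub> False" and ?y = "mk (\<one>\<^bsub>A\<^esub>, v) b False"
    have "?y \<otimes>\<^bsub>G\<^esub> ?x = \<zeta> z \<otimes>\<^bsub>G\<^esub> (?x \<otimes>\<^bsub>G\<^esub> ?y)"
      using ab u v z by (simp add: mk_mult \<zeta>_mult twist_def[of _ False] Z.m_ac)
    then have "\<zeta> z = ?y \<otimes>\<^bsub>G\<^esub> ?x \<otimes>\<^bsub>G\<^esub> inv\<^bsub>G\<^esub> (?x \<otimes>\<^bsub>G\<^esub> ?y)"
      using ab u v z by (simp add: G.inv_solve_right)
    also have "\<dots> \<in> M" using MG u v by (simp add: subgroup.m_closed subgroup.m_inv_closed)
    finally show ?thesis .
  qed
qed

text \<open>Modulo $Z$ every coordinate of an element can be detected by a maximal subgroup: the sign by the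
  Sylow $p$-subgroup, the components in $B$ and $A$ by subgroups of index $p$.\<close>

lemma frattini_eq: "frattini G = \<zeta> ` carrier Z"
proof (intro equalityI subsetI)
  fix x assume "x \<in> \<zeta> ` carrier Z"
  then show "x \<in> frattini G" using \<zeta>_in_maximal by (auto simp: frattini_def)
next
  fix x assume "x \<in> frattini G"
  then have x: "x \<in> carrier G" and max: "\<And>M. maximal_subgroup M G \<Longrightarrow> x \<in> M" by (auto simp: frattini_def)
  obtain n b e where "x = mk n b e" "n \<in> carrier (A \<times>\<times> Z)" "b \<in> carrier B" using mk_cases[OF x] .
  then obtain a z where nbe: "x = mk (a, z) b e" "a \<in> carrier A" "z \<in> carrier Z" "b \<in> carrier B" by auto
  have e: "\<not> e" using max[OF sylow_p_maximal] nbe by (simp add: mk_sylow_p)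
  have b: "b = \<one>\<^bsub>B\<^esub>"
  proof (rule ccontr)
    assume "b \<noteq> \<one>\<^bsub>B\<^esub>"
    then obtain K where K: "subgroup K B" "b \<notin> K" "card K * p = order B" using hyperplane_B nbe by blast
    have "x \<in> {mk n b e | n b e. n \<in> carrier (A \<times>\<times> Z) \<and> b \<in> K}"
      by (rule max, rule lift_maximal[OF N.subgroup_self K(1)])
         (use K(3) in \<open>auto simp: order_def mult.assoc\<close>)
    then show False using K nbe by (auto simp: mk_eq subgroup.mem_carrier)
  qed
  have a: "a = \<one>\<^bsub>A\<^esub>"
  proof (rule ccontr)
    assume "a \<noteq> \<one>\<^bsub>A\<^esub>"
    then obtain K where K: "subgroup K A" "a \<notin> K" "card K * p = order A" using hyperplane_A nbe by blast
    have "x \<in> {mk n b e | n b e. n \<in> K \<times> carrier Z \<and> b \<in> carrier B}"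
      by (rule max, rule lift_maximal[OF DirProd_subgroups[OF A.group_axioms K(1) Z.group_axioms Z.subgroup_self]
            B.subgroup_self])
         (use K in \<open>auto simp: order_def card_cartesian_product subgroup.mem_carrier\<close>)
    then show False using K nbe by (auto simp: mk_eq subgroup.mem_carrier)
  qed
  show "x \<in> \<zeta> ` carrier Z" using nbe a b e by (auto simp: \<zeta>_def)
qed

lemma card_frattini: "card (frattini G) = q"
proof -
  have "inj_on \<zeta> (carrier Z)" by (auto simp: inj_on_def \<zeta>_def mk_eq)
  then show ?thesis by (simp add: frattini_eq card_image order_Z[unfolded order_def])
qed

lemma frattini_coset_eq:
  assumes "a \<in> carrier A" "a' \<in> carrier A" "z \<in> carrier Z" "z' \<in> carrier Z" "b \<in> carrier B" "b' \<in> carrier B"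
  shows "frattini G #>\<^bsub>G\<^esub> mk (a, z) b e = frattini G #>\<^bsub>G\<^esub> mk (a', z') b' e' \<longleftrightarrow>
    a = a' \<and> b = b' \<and> e = e'"
proof
  assume "frattini G #>\<^bsub>G\<^esub> mk (a, z) b e = frattini G #>\<^bsub>G\<^esub> mk (a', z') b' e'"
  then have "mk (a, z) b e \<in> frattini G #>\<^bsub>G\<^esub> mk (a', z') b' e'"
    using G.rcos_self[of "mk (a, z) b e" "frattini G"] assms normal_imp_subgroup[OF \<zeta>_image_normal]
    by (simp add: frattini_eq)
  then show "a = a' \<and> b = b' \<and> e = e'"
    using assms by (auto simp: r_coset_def frattini_eq \<zeta>_mult mk_eq)
next
  assume eq: "a = a' \<and> b = b' \<and> e = e'"
  have "mk (a, z) b e = \<zeta> (z \<otimes>\<^bsub>Z\<^esub> inv\<^bsub>Z\<^esub> z') \<otimes>\<^bsub>G\<^esub> mk (a', z') b' e'"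
    using eq assms by (simp add: \<zeta>_mult Z.m_assoc)
  then have "mk (a, z) b e \<in> frattini G #>\<^bsub>G\<^esub> mk (a', z') b' e'"
    using assms by (auto simp: r_coset_def frattini_eq)
  then show "frattini G #>\<^bsub>G\<^esub> mk (a, z) b e = frattini G #>\<^bsub>G\<^esub> mk (a', z') b' e'"
    using G.repr_independence[OF _ _ normal_imp_subgroup[OF \<zeta>_image_normal]] assms
    by (simp add: frattini_eq)
qed

text \<open>In $G/Z$ the pairing has disappeared: $B$ acts trivially on $N/Z \<cong> A$.\<close>

lemma frattini_quotient:
  "inverted_extension A B (\<lambda>b a. a) p rA s (G Mod frattini G)
     (\<lambda>a b e. frattini G #>\<^bsub>G\<^esub> mk (a, \<one>\<^bsub>Z\<^esub>) b e)"
proof -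
  have "group (G Mod frattini G)"
    using normal.factorgroup_is_group[OF \<zeta>_image_normal] by (simp add: frattini_eq)
  moreover have "carrier (G Mod frattini G) =
      {frattini G #>\<^bsub>G\<^esub> mk (a, \<one>\<^bsub>Z\<^esub>) b e | a b e. a \<in> carrier A \<and> b \<in> carrier B}"
  proof -
    have "\<exists>a b e. frattini G #>\<^bsub>G\<^esub> x = frattini G #>\<^bsub>G\<^esub> mk (a, \<one>\<^bsub>Z\<^esub>) b e \<and> a \<in> carrier A \<and> b \<in> carrier B"
      if x: "x \<in> carrier G" for x
    proof -
      obtain n b e where "x = mk n b e" "n \<in> carrier (A \<times>\<times> Z)" "b \<in> carrier B" using mk_cases[OF x] .
      then obtain a z where "x = mk (a, z) b e" "a \<in> carrier A" "z \<in> carrier Z" "b \<in> carrier B" by auto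
      then show ?thesis using frattini_coset_eq[of a a z "\<one>\<^bsub>Z\<^esub>" b b e e] by auto
    qed
    then show ?thesis unfolding carrier_FactGroup by auto
  qed
  moreover have "(frattini G #>\<^bsub>G\<^esub> mk (a, \<one>\<^bsub>Z\<^esub>) b e) \<otimes>\<^bsub>G Mod frattini G\<^esub>
      (frattini G #>\<^bsub>G\<^esub> mk (a', \<one>\<^bsub>Z\<^esub>) b' e') =
      frattini G #>\<^bsub>G\<^esub> mk (a \<otimes>\<^bsub>A\<^esub> twist A e a', \<one>\<^bsub>Z\<^esub>) (b \<otimes>\<^bsub>B\<^esub> b') (e \<noteq> e')"
    if "a \<in> carrier A" "b \<in> carrier B" "a' \<in> carrier A" "b' \<in> carrier B" for a b e a' b' e'
    using that normal.rcos_sum[OF \<zeta>_image_normal, of "mk (a, \<one>\<^bsub>Z\<^esub>) b e" "mk (a', \<one>\<^bsub>Z\<^esub>) b' e'"]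
    by (simp add: mk_mult frattini_eq[symmetric] frattini_coset_eq)
  ultimately show ?thesis
    using prime odd order_A rA_pos order_B
    by (intro inverted_extension.intro inverted_extension_axioms.intro
          inverted_action.intro inverted_action_axioms.intro A.comm_group_axioms B.comm_group_axioms)
       (auto simp: frattini_coset_eq)
qed

lemma least_number_quotient: "least_system_normalizer_number (G Mod frattini G) 2"
  by (rule inverted_extension.least_number_trivial_action[OF frattini_quotient]) simp

section \<open>Intersections of system normalizers\<close>

text \<open>The conjugate of $B$ by $(a, z)$ consists of the elements with $N$-coordinate
  $(1, \omega(a,b)^{-1})$ and $B$-coordinate $b$. Two conjugates of $B$
  share the one belonging to $b$ exactly if $\omega(a,b) = \omega(a',b)$.\<close>

lemma centralizer_unflipped:
  assumes "a \<in> carrier A" "z \<in> carrier Z" "b \<in> carrier B" "w \<in> carrier Z"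
  shows "mk (\<one>\<^bsub>A\<^esub>, w) b False \<in> involution_centralizer (a, z) \<longleftrightarrow> w = inv\<^bsub>Z\<^esub> \<omega> a b"
proof -
  have "z \<otimes>\<^bsub>Z\<^esub> inv\<^bsub>Z\<^esub> (z \<otimes>\<^bsub>Z\<^esub> \<omega> a b) = inv\<^bsub>Z\<^esub> \<omega> a b"
    using assms by (simp add: Z.inv_mult Z.m_assoc[symmetric])
  then show ?thesis using assms by (simp add: mem_involution_centralizer twist_def)
qed

text \<open>Given at most $m$ system normalizers, fix one of them, with parameter $a_0$. The map
  $b \<mapsto> (\omega(a,b)\,\omega(a_0,b)^{-1})_a$, where $a$ ranges over the parameters of the others, goes from a set
  of $q^m$ elements to one of at most $q^{m-1}$, so it is not injective. The quotient $c$ of two elements with equal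
  images has the same pairing with all parameters, and so yields a nontrivial element of the intersection.\<close>

lemma family_lower_bound:
  assumes \<D>: "hypercenter_family G \<D>"
  shows "m + 1 \<le> card \<D>"
proof (rule ccontr)
  assume "\<not> m + 1 \<le> card \<D>"
  have fin: "finite \<D>" "\<D> \<noteq> {}" and sub: "\<D> \<subseteq> involution_centralizer ` carrier (A \<times>\<times> Z)"
    and inter: "\<Inter>\<D> = {\<one>\<^bsub>G\<^esub>}"
    using \<D> by (auto simp: hypercenter_family_def system_normalizers_eq hypercenter_trivial)
  obtain S where S: "S \<subseteq> carrier A \<times> carrier Z" "inj_on involution_centralizer S"
    "\<D> = involution_centralizer ` S"
    using sub by (auto simp: subset_image_inj)
  have card_S: "card S = card \<D>" and finS: "finite S" using S fin by (auto simp: card_image finite_image_iff)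
  obtain a0 z0 where s0: "(a0, z0) \<in> S" using S fin by auto
  let ?T = "S - {(a0, z0)}"
  define F where "F b = (\<lambda>h\<in>?T. \<omega> (fst h) b \<otimes>\<^bsub>Z\<^esub> inv\<^bsub>Z\<^esub> \<omega> a0 b)" for b
  have a0: "a0 \<in> carrier A" "z0 \<in> carrier Z" using s0 S by auto
  have in_A: "fst h \<in> carrier A" if "h \<in> S" for h using S that by auto
  have "F ` carrier B \<subseteq> PiE ?T (\<lambda>_. carrier Z)"
  proof -
    have "F b \<in> PiE ?T (\<lambda>_. carrier Z)" if "b \<in> carrier B" for b
      unfolding F_def restrict_PiE_iff using a0 in_A that by simp
    then show ?thesis by blast
  qed
  moreover have "card (PiE ?T (\<lambda>_. carrier Z)) < card (carrier B)"
  proof -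
    have "card ?T < m" using \<open>\<not> m + 1 \<le> card \<D>\<close> s0 finS m_pos card_S by (simp add: card_Diff_singleton)
    then have "q ^ card ?T < q ^ m" using q_gt_1 by simp
    then show ?thesis using finS order_Z order_B_q by (simp add: card_PiE order_def)
  qed
  moreover have "finite (PiE ?T (\<lambda>_. carrier Z))" using finS by (simp add: finite_PiE)
  ultimately have "\<not> inj_on F (carrier B)" by (meson card_inj_on_le not_le)
  then obtain b b' where b: "b \<in> carrier B" "b' \<in> carrier B" "b \<noteq> b'" "F b = F b'" by (auto simp: inj_on_def)
  define c where "c = b \<otimes>\<^bsub>B\<^esub> inv\<^bsub>B\<^esub> b'"
  have c: "c \<in> carrier B" "c \<noteq> \<one>\<^bsub>B\<^esub>"
    using b by (auto simp: c_def) (metis B.inv_closed B.inv_equality B.inv_inv)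
  have same: "\<omega> (fst h) c = \<omega> a0 c" if h: "h \<in> S" for h
  proof (cases "h = (a0, z0)")
    case False
    have eq: "\<omega> (fst h) b \<otimes>\<^bsub>Z\<^esub> inv\<^bsub>Z\<^esub> \<omega> a0 b = \<omega> (fst h) b' \<otimes>\<^bsub>Z\<^esub> inv\<^bsub>Z\<^esub> \<omega> a0 b'"
      using fun_cong[OF b(4), of h] h False by (simp add: F_def)
    show ?thesis
      using Z.quotient_swap[OF eq] a0 in_A[OF h] b by (simp add: c_def \<omega>_mult_right \<omega>_inv_right)
  qed simp
  (* This is the element c of B, conjugated into the system normalizer that was fixed. *)
  let ?x = "mk (\<one>\<^bsub>A\<^esub>, inv\<^bsub>Z\<^esub> \<omega> a0 c) c False"
  have "?x \<in> involution_centralizer h" if h: "h \<in> S" for h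
    using centralizer_unflipped[of "fst h" "snd h" c "inv\<^bsub>Z\<^esub> \<omega> a0 c"] S h c a0 same[OF h]
    by (auto dest: subsetD)
  then have "?x \<in> \<Inter>\<D>" using S by blast
  then show False using inter c a0 by (simp add: one_G mk_eq)
qed

text \<open>The system normalizers with parameters $1, \alpha_0, \ldots, \alpha_{m-1}$ have trivial
  intersection: an element without involution lies in $B$ and is annihilated by all $\alpha_i$, and an element
  with involution would require all $\alpha_i$ to be trivial, so that they would not detect $B \<noteq> 1$.\<close>

lemma least_number: "least_system_normalizer_number G (m + 1)"
proof -
  let ?H = "insert (\<one>\<^bsub>A\<^esub>, \<one>\<^bsub>Z\<^esub>) ((\<lambda>i. (\<alpha> i, \<one>\<^bsub>Z\<^esub>)) ` {..<m})"
  let ?D = "involution_centralizer ` ?H"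
  have H: "?H \<subseteq> carrier (A \<times>\<times> Z)" using \<alpha>_in by auto
  have "x = \<one>\<^bsub>G\<^esub>" if x: "x \<in> \<Inter>?D" for x
  proof -
    have "x \<in> carrier G" using x involution_centralizer_in[of "(\<one>\<^bsub>A\<^esub>, \<one>\<^bsub>Z\<^esub>)"] by auto
    then obtain n b e where nbe: "x = mk n b e" "n \<in> carrier (A \<times>\<times> Z)" "b \<in> carrier B" by (rule mk_cases)
    have "n = (\<one>\<^bsub>A\<^esub>, \<one>\<^bsub>Z\<^esub>)"
      using x nbe mem_involution_centralizer[of "(\<one>\<^bsub>A\<^esub>, \<one>\<^bsub>Z\<^esub>)" n b e]
      by (auto simp: twist_def split: if_splits)
    then have i: "(\<one>\<^bsub>A\<^esub>, \<one>\<^bsub>Z\<^esub>) = (\<alpha> i \<otimes>\<^bsub>A\<^esub> twist A e (inv\<^bsub>A\<^esub> \<alpha> i), twist Z e (inv\<^bsub>Z\<^esub> \<omega> (\<alpha> i) b))"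
      if "i < m" for i
      using x nbe mem_involution_centralizer[of "(\<alpha> i, \<one>\<^bsub>Z\<^esub>)" n b e] \<alpha>_in[OF that] that by auto
    have b: "b = \<one>\<^bsub>B\<^esub>"
    proof (rule \<alpha>_detects[OF nbe(3)])
      fix i assume i': "i < m"
      show "\<omega> (\<alpha> i) b = \<one>\<^bsub>Z\<^esub>" using i[OF i'] \<alpha>_in[OF i'] nbe(3)
        by (auto simp: twist_def split: if_splits) (metis Z.inv_eq_1_iff \<omega>_closed)
    qed
    have "\<not> e"
    proof
      assume e
      have "\<alpha> i = \<one>\<^bsub>A\<^esub>" if "i < m" for i
      proof -
        have "\<alpha> i \<otimes>\<^bsub>A\<^esub> \<alpha> i = \<one>\<^bsub>A\<^esub> \<otimes>\<^bsub>A\<^esub> \<one>\<^bsub>A\<^esub>" using i[OF that] \<alpha>_in[OF that] \<open>e\<close> by (simp add: twist_def)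
        then show ?thesis using A.square_inj[of "\<alpha> i" "\<one>\<^bsub>A\<^esub>"] \<alpha>_in[OF that] odd by (simp add: order_A)
      qed
      then have "carrier B = {\<one>\<^bsub>B\<^esub>}" using \<alpha>_detects by auto
      then have "q ^ m = 1" by (simp add: order_def flip: order_B_q)
      then show False using q_gt_1 m_pos by simp
    qed
    then show ?thesis using nbe b \<open>n = _\<close> by (simp add: one_G)
  qed
  moreover have "\<one>\<^bsub>G\<^esub> \<in> D" if "D \<in> ?D" for D
    using that \<alpha>_in by (auto simp: one_G mem_involution_centralizer twist_def)
  ultimately have "\<Inter>?D = {\<one>\<^bsub>G\<^esub>}" by blast
  then have fam: "hypercenter_family G ?D"
    using H by (auto simp: hypercenter_family_def system_normalizers_eq hypercenter_trivial)
  have "card ?D \<le> card ?H" by (rule card_image_le) simp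
  also have "\<dots> \<le> m + 1" using card_image_le[of "{..<m}" "\<lambda>i. (\<alpha> i, \<one>\<^bsub>Z\<^esub>)"] by (simp add: card_insert_if)
  finally have "card ?D = m + 1" using family_lower_bound[OF fam] by simp
  then show ?thesis using fam family_lower_bound unfolding least_system_normalizer_number_def by blast
qed

end

section \<open>A pairing over the prime field\<close>

text \<open>The group $\mathbb{F}_p^I$.\<close>

definition vectors :: "nat \<Rightarrow> 'i set \<Rightarrow> ('i \<Rightarrow> int) monoid" where
  "vectors p I = \<lparr>carrier = I \<rightarrow>\<^sub>E {0..<int p},
     monoid.mult = (\<lambda>f g. \<lambda>i\<in>I. (f i + g i) mod int p), monoid.one = (\<lambda>i\<in>I. 0)\<rparr>"

lemma carrier_vectors: "carrier (vectors p I) = I \<rightarrow>\<^sub>E {0..<int p}"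
  and mult_vectors: "f \<otimes>\<^bsub>vectors p I\<^esub> g = (\<lambda>i\<in>I. (f i + g i) mod int p)"
  and one_vectors: "\<one>\<^bsub>vectors p I\<^esub> = (\<lambda>i\<in>I. 0)"
  by (simp_all add: vectors_def)

lemma vectors_eqI:
  assumes "f \<in> carrier (vectors p I)" "g \<in> carrier (vectors p I)" "\<And>i. i \<in> I \<Longrightarrow> f i = g i"
  shows "f = g"
  using assms by (auto simp: carrier_vectors intro: PiE_ext)

lemma restrict_mod_in_vectors: "p > 0 \<Longrightarrow> (\<lambda>i\<in>I. h i mod int p) \<in> carrier (vectors p I)"
  by (auto simp: carrier_vectors)

lemma vectors_mod:
  assumes "f \<in> carrier (vectors p I)" "i \<in> I"
  shows "f i mod int p = f i"
proof -
  have "f i \<in> {0..<int p}" using assms by (auto simp: carrier_vectors)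
  then show ?thesis by simp
qed

lemma vectors_comm_group:
  assumes p: "p > 0"
  shows "comm_group (vectors p I)"
proof (rule comm_groupI)
  fix f g assume "f \<in> carrier (vectors p I)" "g \<in> carrier (vectors p I)"
  then show "f \<otimes>\<^bsub>vectors p I\<^esub> g \<in> carrier (vectors p I)" and "f \<otimes>\<^bsub>vectors p I\<^esub> g = g \<otimes>\<^bsub>vectors p I\<^esub> f"
    using restrict_mod_in_vectors[OF p] by (auto simp: mult_vectors add.commute)
next
  show "\<one>\<^bsub>vectors p I\<^esub> \<in> carrier (vectors p I)" using p by (simp add: one_vectors carrier_vectors)
next
  fix f g h :: "'a \<Rightarrow> int"
  show "f \<otimes>\<^bsub>vectors p I\<^esub> g \<otimes>\<^bsub>vectors p I\<^esub> h = f \<otimes>\<^bsub>vectors p I\<^esub> (g \<otimes>\<^bsub>vectors p I\<^esub> h)"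
    unfolding mult_vectors by (rule restrict_ext) (simp add: mod_simps add.assoc)
next
  fix f assume f: "f \<in> carrier (vectors p I)"
  show "\<one>\<^bsub>vectors p I\<^esub> \<otimes>\<^bsub>vectors p I\<^esub> f = f"
  proof (rule vectors_eqI[OF _ f])
    show "\<one>\<^bsub>vectors p I\<^esub> \<otimes>\<^bsub>vectors p I\<^esub> f \<in> carrier (vectors p I)"
      unfolding mult_vectors by (rule restrict_mod_in_vectors[OF p])
  qed (simp add: mult_vectors one_vectors vectors_mod[OF f])
  have "(\<lambda>i\<in>I. (- f i) mod int p) \<otimes>\<^bsub>vectors p I\<^esub> f = \<one>\<^bsub>vectors p I\<^esub>"
    unfolding mult_vectors one_vectors by (rule restrict_ext) (simp add: mod_simps)
  then show "\<exists>g\<in>carrier (vectors p I). g \<otimes>\<^bsub>vectors p I\<^esub> f = \<one>\<^bsub>vectors p I\<^esub>"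
    using restrict_mod_in_vectors[OF p, of "\<lambda>i. - f i" I] by blast
qed

lemma order_vectors: "finite I \<Longrightarrow> order (vectors p I) = p ^ card I"
  by (simp add: order_def carrier_vectors card_PiE)

lemma vectors_hyperplane:
  assumes p: "p > 0" and fin: "finite I"
    and f: "f \<in> carrier (vectors p I)" "f \<noteq> \<one>\<^bsub>vectors p I\<^esub>"
  shows "\<exists>K. subgroup K (vectors p I) \<and> f \<notin> K \<and> card K * p = order (vectors p I)"
proof -
  interpret V: comm_group "vectors p I" by (rule vectors_comm_group[OF p])
  obtain i where i: "i \<in> I" "f i \<noteq> 0"
    using vectors_eqI[OF f(1) V.one_closed] f(2) by (auto simp: one_vectors)
  let ?K = "{g \<in> carrier (vectors p I). g i = 0}"
  have "subgroup ?K (vectors p I)"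
  proof (rule V.finite_closed_subgroup)
    show "finite (carrier (vectors p I))" using fin by (auto simp: carrier_vectors intro: finite_PiE)
    fix x y assume xy: "x \<in> ?K" "y \<in> ?K"
    then have "x \<otimes>\<^bsub>vectors p I\<^esub> y \<in> carrier (vectors p I)" by simp
    moreover have "(x \<otimes>\<^bsub>vectors p I\<^esub> y) i = 0" using xy i by (simp add: mult_vectors)
    ultimately show "x \<otimes>\<^bsub>vectors p I\<^esub> y \<in> ?K" by simp
  next
    have "\<one>\<^bsub>vectors p I\<^esub> i = 0" using i by (simp add: one_vectors)
    then show "\<one>\<^bsub>vectors p I\<^esub> \<in> ?K" by simp
  qed blast
  moreover have "card ?K * p = order (vectors p I)"
  proof -
    have "?K = PiE I (\<lambda>j. if j = i then {0} else {0..<int p})"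
    proof (intro equalityI subsetI)
      fix g assume g: "g \<in> PiE I (\<lambda>j. if j = i then {0} else {0..<int p})"
      then have mem: "g j \<in> (if j = i then {0} else {0..<int p})" if "j \<in> I" for j
        using that by (rule PiE_mem)
      have "g i = 0" using mem[OF i(1)] by simp
      moreover have "g j \<in> {0..<int p}" if "j \<in> I" for j
        using mem[OF that] p by (cases "j = i") auto
      ultimately show "g \<in> ?K" using g by (simp add: carrier_vectors PiE_iff)
    qed (auto simp: carrier_vectors PiE_iff)
    then have "card ?K = (\<Prod>j\<in>I. card (if j = i then {0} else {0..<int p}))" by (simp add: card_PiE fin)
    also have "\<dots> = (\<Prod>j\<in>I - {i}. card (if j = i then {0} else {0..<int p}))"
      using prod.remove[OF fin i(1), of "\<lambda>j. card (if j = i then {0} else {0..<int p})"] by simp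
    also have "\<dots> = (\<Prod>j\<in>I - {i}. p)" by (rule prod.cong) auto
    finally have "card ?K = p ^ (card I - 1)" using i fin by simp
    moreover have "card I > 0" using i fin card_gt_0_iff by blast
    ultimately show ?thesis using fin power_minus_mult[of "card I" p] by (simp add: order_vectors)
  qed
  ultimately show ?thesis using i by blast
qed

text \<open>A matrix over $\mathbb{F}_p$ with $m$ rows and $k$ columns stands for an element of $V^m$,
  where $V = \mathbb{F}_p^k$. The first column of $a$ gives the scalars of a linear combination of the rows of $b$; the
  other columns of $a$ only serve to give $A$ the order $q^m$.\<close>

definition pairing :: "nat \<Rightarrow> nat \<Rightarrow> nat \<Rightarrow> (nat \<times> nat \<Rightarrow> int) \<Rightarrow> (nat \<times> nat \<Rightarrow> int) \<Rightarrow> nat \<Rightarrow> int" where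
  "pairing p m k a b = (\<lambda>j\<in>{..<k}. (\<Sum>i<m. a (i, 0) * b (i, j)) mod int p)"

lemma sum_mod_cong:
  fixes f g :: "'i \<Rightarrow> int"
  assumes "\<And>i. i \<in> S \<Longrightarrow> f i mod c = g i mod c"
  shows "sum f S mod c = sum g S mod c"
  by (metis (mono_tags, lifting) assms mod_sum_eq sum.cong)

lemma pairing_add_left:
  assumes "k > 0"
  shows "pairing p m k (a \<otimes>\<^bsub>vectors p ({..<m} \<times> {..<k})\<^esub> a') b =
    pairing p m k a b \<otimes>\<^bsub>vectors p {..<k}\<^esub> pairing p m k a' b"
proof -
  have "(\<Sum>i<m. (a \<otimes>\<^bsub>vectors p ({..<m} \<times> {..<k})\<^esub> a') (i, 0) * b (i, j)) mod int p =
      (\<Sum>i<m. a (i, 0) * b (i, j) + a' (i, 0) * b (i, j)) mod int p" for j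
    by (rule sum_mod_cong) (use assms in \<open>simp add: mult_vectors mod_simps distrib_right\<close>)
  then show ?thesis by (auto simp: pairing_def mult_vectors mod_simps sum.distrib)
qed

lemma pairing_add_right:
  "pairing p m k a (b \<otimes>\<^bsub>vectors p ({..<m} \<times> {..<k})\<^esub> b') =
    pairing p m k a b \<otimes>\<^bsub>vectors p {..<k}\<^esub> pairing p m k a b'"
proof -
  have "(\<Sum>i<m. a (i, 0) * (b \<otimes>\<^bsub>vectors p ({..<m} \<times> {..<k})\<^esub> b') (i, j)) mod int p =
      (\<Sum>i<m. a (i, 0) * b (i, j) + a (i, 0) * b' (i, j)) mod int p" if "j < k" for j
    by (rule sum_mod_cong) (use that in \<open>simp add: mult_vectors mod_simps distrib_left\<close>)
  then show ?thesis by (auto simp: pairing_def mult_vectors mod_simps sum.distrib)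
qed

definition unit_row :: "nat \<Rightarrow> nat \<Rightarrow> nat \<Rightarrow> nat \<times> nat \<Rightarrow> int" where
  "unit_row m k i = (\<lambda>x\<in>{..<m} \<times> {..<k}. if x = (i, 0) then 1 else 0)"

lemma pairing_unit_row:
  assumes "i < m" "k > 0"
  shows "pairing p m k (unit_row m k i) b = (\<lambda>j\<in>{..<k}. b (i, j) mod int p)"
proof -
  have "(\<Sum>i'<m. unit_row m k i (i', 0) * b (i', j)) = b (i, j)" for j
  proof -
    have "(\<Sum>i'<m. unit_row m k i (i', 0) * b (i', j)) = (\<Sum>i'<m. if i' = i then b (i', j) else 0)"
      by (rule sum.cong) (use assms in \<open>auto simp: unit_row_def\<close>)
    then show ?thesis using assms by simp
  qed
  then show ?thesis by (simp add: pairing_def)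
qed

lemma DirProd_comm_group:
  assumes "comm_group G" "comm_group H"
  shows "comm_group (G \<times>\<times> H)"
proof -
  interpret G: comm_group G by fact
  interpret H: comm_group H by fact
  show ?thesis
    by (rule group.group_comm_groupI[OF DirProd_group[OF G.group_axioms H.group_axioms]])
       (auto simp: G.m_comm H.m_comm)
qed

lemma order_DirProd: "order (G \<times>\<times> H) = order G * order H"
  by (simp add: order_def card_cartesian_product)

lemma pairing_in: "p > 0 \<Longrightarrow> pairing p m k a b \<in> carrier (vectors p {..<k})"
  unfolding pairing_def by (rule restrict_mod_in_vectors)

lemma pairing_action:
  fixes p m k :: nat
  assumes p: "Factorial_Ring.prime p" "odd p" and k: "k > 0"
  defines "A \<equiv> vectors p ({..<m} \<times> {..<k})" and "Z \<equiv> vectors p {..<k}"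
  shows "inverted_action (A \<times>\<times> Z) A (\<lambda>b (a, z). (a, z \<otimes>\<^bsub>Z\<^esub> pairing p m k a b)) p (m * k + k) (m * k)"
proof -
  have p0: "p > 0" by (rule prime_gt_0_nat[OF p(1)])
  interpret A: comm_group A unfolding A_def by (rule vectors_comm_group[OF p0])
  interpret Z: comm_group Z unfolding Z_def by (rule vectors_comm_group[OF p0])
  note [simp] = pairing_in[OF p0, of m k, folded Z_def]
  have "pairing p m k (a \<otimes>\<^bsub>A\<^esub> a') b = pairing p m k a b \<otimes>\<^bsub>Z\<^esub> pairing p m k a' b" for a a' b
    unfolding A_def Z_def by (rule pairing_add_left[OF k])
  moreover have "pairing p m k a (b \<otimes>\<^bsub>A\<^esub> b') = pairing p m k a b \<otimes>\<^bsub>Z\<^esub> pairing p m k a b'" for a b b'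
    unfolding A_def Z_def by (rule pairing_add_right)
  moreover from this[of _ "\<one>\<^bsub>A\<^esub>" "\<one>\<^bsub>A\<^esub>"] have "pairing p m k a \<one>\<^bsub>A\<^esub> = \<one>\<^bsub>Z\<^esub>" for a
    by (metis A.l_one A.one_closed Z.r_cancel_one' \<open>\<And>b a. pairing p m k a b \<in> carrier Z\<close>)
  ultimately show ?thesis using p k
    by (intro inverted_action.intro inverted_action_axioms.intro DirProd_comm_group
          A.comm_group_axioms Z.comm_group_axioms)
       (auto simp: order_DirProd A_def[THEN meta_eq_to_obj_eq, THEN arg_cong, of order]
          Z_def[THEN meta_eq_to_obj_eq, THEN arg_cong, of order]
          order_vectors power_add card_cartesian_product Z.m_ac)
qed

theorem theorem1:
  fixes q m :: nat
  assumes "primepow q" and "odd q" and "m \<ge> 1"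
  shows "\<exists>G :: nat monoid.
    group G \<and> finite (carrier G) \<and> metabelian G \<and>
    order G = 2 * q ^ (2 * m + 1) \<and>
    hypercenter G = {\<one>\<^bsub>G\<^esub>} \<and>
    card (frattini G) = q \<and>
    least_system_normalizer_number G (m + 1) \<and>
    least_system_normalizer_number (G Mod frattini G) 2"
proof -
  obtain p k where p: "Factorial_Ring.prime p" and k: "k > 0" and q: "q = p ^ k"
    using assms(1) by (auto simp: primepow_def)
  have odd_p: "odd p" using assms(2) k by (simp add: q)
  have p1: "p > 1" by (rule prime_gt_1_nat[OF p])
  then have p0: "p > 0" by simp
  define A where "A = vectors p ({..<m} \<times> {..<k})"
  define Z where "Z = vectors p {..<k}"
  interpret A: comm_group A unfolding A_def by (rule vectors_comm_group[OF p0])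
  interpret Z: comm_group Z unfolding Z_def by (rule vectors_comm_group[OF p0])
  have order_A: "order A = p ^ (m * k)"
    by (simp add: A_def order_vectors card_cartesian_product)
  obtain G :: "nat monoid" and mk where ext: "inverted_extension (A \<times>\<times> Z) A
      (\<lambda>b (a, z). (a, z \<otimes>\<^bsub>Z\<^esub> pairing p m k a b)) p (m * k + k) (m * k) G mk"
    using inverted_action.extension_on_nat[OF pairing_action[OF p odd_p k, of m, folded A_def Z_def]] .
  have row: "unit_row m k i \<in> carrier A" if "i < m" for i
    using that k p1 by (auto simp: A_def carrier_vectors unit_row_def)
  have pair_row: "pairing p m k (unit_row m k i) b = (\<lambda>j\<in>{..<k}. b (i, j))"
    if "i < m" "b \<in> carrier A" for i b
    using that vectors_mod[of b p "{..<m} \<times> {..<k}"]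
    by (auto simp: pairing_unit_row[OF that(1) k] A_def)
  interpret T: twisted_heisenberg A Z A "pairing p m k" p "m * k + k" "m * k" G mk
    "m * k" q m "unit_row m k"
  proof (intro twisted_heisenberg.intro twisted_heisenberg_axioms.intro ext
      A.comm_group_axioms Z.comm_group_axioms)
    show "order A = p ^ (m * k)" "0 < m * k" "1 \<le> m" "order A = q ^ m" "order Z = q" "1 < q"
      using order_A k assms(3) one_less_power[OF p1 k] by (simp_all add: q Z_def order_vectors power_mult[symmetric] mult.commute)
    show "pairing p m k a b \<in> carrier Z" for a b
      unfolding Z_def by (rule pairing_in[OF p0])
    show "unit_row m k i \<in> carrier A" if "i < m" for i by (rule row[OF that])
    show "\<exists>K. subgroup K A \<and> a \<notin> K \<and> card K * p = order A"
      if "a \<in> carrier A" "a \<noteq> \<one>\<^bsub>A\<^esub>" for a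
      using that vectors_hyperplane[OF p0, of "{..<m} \<times> {..<k}" a] by (simp add: A_def)
    (* The same group serves as A and as B. *)
    then show "\<exists>K. subgroup K A \<and> a \<notin> K \<and> card K * p = order A"
      if "a \<in> carrier A" "a \<noteq> \<one>\<^bsub>A\<^esub>" for a
      using that by blast
    show "b = \<one>\<^bsub>A\<^esub>" if b: "b \<in> carrier A"
      and ker: "\<And>i. i < m \<Longrightarrow> pairing p m k (unit_row m k i) b = \<one>\<^bsub>Z\<^esub>" for b
    proof -
      have "b (i, j) = 0" if "i < m" "j < k" for i j
        using fun_cong[OF ker[OF that(1)], of j] pair_row[OF that(1) b] that by (simp add: Z_def one_vectors)
      then show ?thesis
        using b A.one_closed by (intro vectors_eqI[of _ p "{..<m} \<times> {..<k}"]) (auto simp: A_def one_vectors)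
    qed
    show "\<exists>a \<in> carrier A. \<exists>b \<in> carrier A. pairing p m k a b = z" if z: "z \<in> carrier Z" for z
    proof (intro bexI)
      let ?b = "\<lambda>(i, j)\<in>{..<m} \<times> {..<k}. z j"
      show b: "?b \<in> carrier A" using z by (auto simp: A_def Z_def carrier_vectors)
      show "unit_row m k 0 \<in> carrier A" using row assms(3) by simp
      have "pairing p m k (unit_row m k 0) ?b = (\<lambda>j\<in>{..<k}. z j)"
        using pair_row[OF _ b, of 0] assms(3) by auto
      also have "\<dots> = z" using z by (simp add: Z_def carrier_vectors PiE_restrict)
      finally show "pairing p m k (unit_row m k 0) ?b = z" .
    qed
  qed
  have "m * k + k + m * k = k * (2 * m + 1)" by (simp add: algebra_simps)
  then have "order G = 2 * q ^ (2 * m + 1)"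
    using T.order_G by (simp only: q power_mult)
  then show ?thesis
    using T.G.group_axioms T.finite_G T.metabelian_G T.hypercenter_trivial T.card_frattini
      T.least_number T.least_number_quotient by blast
qed

end
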